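(* Let $\mathcal{L}$ be a complex $(n+1)$-dimensional $3$-filiform non-Lie Leibniz algebra whose associated naturally graded algebra $\mathrm{gr}\,\mathcal{L}$ is isomorphic to $KF_5\oplus\mathbb{C}$. Then $l(\mathcal{L})\le n$.
   Context: All algebras are finite-dimensional over $\mathbb{C}$. A Leibniz algebra is a vector space $\mathcal{L}$ with a bilinear product $[\cdot,\cdot]$ satisfying $[x,[y,z]]=[[x,y],z]-[[x,z],y]$ for all $x,y,z$; it is non-Lie if it is not a Lie algebra. The descending central sequence is $\mathcal{L}^1=\mathcal{L}$, $\mathcal{L}^{k+1}=[\mathcal{L}^k,\mathcal{L}]$; $\mathcal{L}$ is nilpotent if $\mathcal{L}^{k}=0$ for some $k$. For nilpotent $\mathcal{L}$, put $\mathcal{L}_i=\mathcal{L}^i/\mathcal{L}^{i+1}$ and $\mathrm{gr}\,\mathcal{L}=\bigoplus_i\mathcal{L}_i$ with the induced product, $[\mathcal{L}_i,\mathcal{L}_j]\subseteq\mathcal{L}_{i+j}$; this is the associated naturally graded algebra. For $x\in\mathcal{L}$ let $R_x(y)=[y,x]$. For $\mathcal{L}$ nilpotent and $x\in\mathcal{L}\setminus\mathcal{L}^2$ let $C(x)$ be the decreasing sequence of the sizes of the Jordan blocks of the nilpotent operator $R_x$. The characteristic sequence $C(\mathcal{L})$ is the maximum of $C(x)$ over $x\in\mathcal{L}\setminus\mathcal{L}^2$ in the lexicographic order. A nilpotent Leibniz algebra of dimension $m$ is $3$-filiform if $C(\mathcal{L})=(m-3,1,1,1)$. A connected gradation of $\mathcal{L}$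 is a vector space decomposition $\mathcal{L}=V_{k}\oplus V_{k+1}\oplus\dots\oplus V_{k+t}$, with $k\in\mathbb{Z}$, all $V_{k+i}\ne 0$ for $0\le i\le t$, and $[V_i,V_j]\subseteq V_{i+j}$ for all $i,j\in\mathbb{Z}$ (where $V_i=0$ for indices outside $\{k,\dots,k+t\}$). Its length is $t+1$. The length $l(\mathcal{L})$ is the maximal length of a connected gradation of $\mathcal{L}$. $KF_5$ is the $n$-dimensional naturally graded $2$-filiform Leibniz algebra (characteristic sequence $(n-2,1,1)$) with basis $\{e_1,\dots,e_n\}$ and nonzero products $[e_i,e_1]=e_{i+1}$ for $1\le i\le n-3$, $[e_1,e_{n-1}]=e_2+e_n$, and $[e_i,e_{n-1}]=e_{i+1}$ for $2\le i\le n-3$. $KF_5\oplus\mathbb{C}$ is its direct sum with the one-dimensional algebra with zero product.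
   Formalization: The formal statement assumes n ≥ 6: for n = 4 and n = 5 the algebra KF_5 ⊕ C itself has a connected gradation of length n+1, so the claim fails there, and for n ≤ 3 the table does not define a 2-filiform Leibniz algebra KF_5. *)

theory Defs
  imports
    "Jordan_Normal_Form.Jordan_Normal_Form"
    "HOL-Library.Set_Algebras"
    "HOL-Library.List_Lexorder"
begin

locale leibniz_algebra = vector_space scale
  for scale :: "complex \<Rightarrow> 'a::ab_group_add \<Rightarrow> 'a" +
  fixes br :: "'a \<Rightarrow> 'a \<Rightarrow> 'a"
  assumes br_add_left: "br (x + y) z = br x z + br y z"
    and br_add_right: "br x (y + z) = br x y + br x z"
    and br_scale_left: "br (scale c x) y = scale c (br x y)"
    and br_scale_right: "br x (scale c y) = scale c (br x y)"
    and leibniz: "br x (br y z) = br (br x y) z - br (br x z) y"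
    and finite_dim: "\<exists>B. finite B \<and> module.span scale B = UNIV"

definition is_lie :: "('a::ab_group_add \<Rightarrow> 'a \<Rightarrow> 'a) \<Rightarrow> bool" where
  "is_lie br \<longleftrightarrow> (\<forall>x. br x x = 0) \<and>
     (\<forall>x y z. br x (br y z) + br y (br z x) + br z (br x y) = 0)"

context
  fixes scale :: "complex \<Rightarrow> 'a::ab_group_add \<Rightarrow> 'a"
    and br :: "'a \<Rightarrow> 'a \<Rightarrow> 'a"
begin

text \<open>The descending central sequence is indexed from 1; the value at 0 only
  makes the function total.\<close>

fun lcs :: "nat \<Rightarrow> 'a set" where
  "lcs 0 = UNIV"
| "lcs (Suc 0) = UNIV"
| "lcs (Suc (Suc k)) = module.span scale {br x y | x y. x \<in> lcs (Suc k)}"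

definition nilpotent_alg :: bool where
  "nilpotent_alg \<longleftrightarrow> (\<exists>k\<ge>1. lcs k = {0})"

definition ordered_basis :: "'a list \<Rightarrow> bool" where
  "ordered_basis bs \<longleftrightarrow> distinct bs \<and> \<not> module.dependent scale (set bs)
     \<and> module.span scale (set bs) = UNIV"

definition represents :: "'a list \<Rightarrow> complex mat \<Rightarrow> ('a \<Rightarrow> 'a) \<Rightarrow> bool" where
  "represents bs A T \<longleftrightarrow> A \<in> carrier_mat (length bs) (length bs) \<and>
     (\<forall>j<length bs. T (bs ! j) = (\<Sum>i<length bs. scale (A $$ (i, j)) (bs ! i)))"

text \<open>For a nilpotent operator all eigenvalues are 0; the sizes in a
  \<^const>\<open>jordan_nf\<close> are positive by definition.\<close>

definition nilp_jordan_sizes :: "('a \<Rightarrow> 'a) \<Rightarrow> nat list \<Rightarrow> bool" where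
  "nilp_jordan_sizes T ns \<longleftrightarrow> sorted_wrt (\<ge>) ns \<and>
     (\<exists>bs A. ordered_basis bs \<and> represents bs A T \<and> jordan_nf A (map (\<lambda>k. (k, 0)) ns))"

definition char_seq_at :: "'a \<Rightarrow> nat list" where
  "char_seq_at x = (THE ns. nilp_jordan_sizes (\<lambda>y. br y x) ns)"

text \<open>\<^const>\<open>Max\<close> refers to the lexicographic order on lists.\<close>

definition char_seq :: "nat list" where
  "char_seq = Max (char_seq_at ` (UNIV - lcs 2))"

definition three_filiform :: bool where
  "three_filiform \<longleftrightarrow> nilpotent_alg \<and>
     char_seq = [vector_space.dim scale (UNIV :: 'a set) - 3, 1, 1, 1]"

definition connected_gradation :: "(int \<Rightarrow> 'a set) \<Rightarrow> int \<Rightarrow> nat \<Rightarrow> bool" where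
  "connected_gradation V k t \<longleftrightarrow>
     (\<forall>i. module.subspace scale (V i)) \<and>
     (\<forall>i\<in>{k..k + int t}. V i \<noteq> {0}) \<and>
     (\<forall>i. i \<notin> {k..k + int t} \<longrightarrow> V i = {0}) \<and>
     (\<forall>x. \<exists>!f. (\<forall>i. f i \<in> V i) \<and> x = (\<Sum>i\<in>{k..k + int t}. f i)) \<and>
     (\<forall>i j. \<forall>x\<in>V i. \<forall>y\<in>V j. br x y \<in> V (i + j))"

definition alg_length :: nat where
  "alg_length = Max {t + 1 | V k t. connected_gradation V k t}"

end

record 'a calg =
  cal_carrier :: "'a set"
  cal_add :: "'a \<Rightarrow> 'a \<Rightarrow> 'a"
  cal_scale :: "complex \<Rightarrow> 'a \<Rightarrow> 'a"
  cal_mult :: "'a \<Rightarrow> 'a \<Rightarrow> 'a"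

definition calg_iso :: "'a calg \<Rightarrow> 'b calg \<Rightarrow> bool" where
  "calg_iso A B \<longleftrightarrow> (\<exists>\<phi>. bij_betw \<phi> (cal_carrier A) (cal_carrier B) \<and>
     (\<forall>x\<in>cal_carrier A. \<forall>y\<in>cal_carrier A.
        \<phi> (cal_add A x y) = cal_add B (\<phi> x) (\<phi> y) \<and>
        \<phi> (cal_mult A x y) = cal_mult B (\<phi> x) (\<phi> y)) \<and>
     (\<forall>c. \<forall>x\<in>cal_carrier A. \<phi> (cal_scale A c x) = cal_scale B c (\<phi> x)))"

definition calg_sum :: "'a calg \<Rightarrow> 'b calg \<Rightarrow> ('a \<times> 'b) calg" where
  "calg_sum A B = \<lparr>
     cal_carrier = cal_carrier A \<times> cal_carrier B,
     cal_add = (\<lambda>x y. (cal_add A (fst x) (fst y), cal_add B (snd x) (snd y))),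
     cal_scale = (\<lambda>c x. (cal_scale A c (fst x), cal_scale B c (snd x))),
     cal_mult = (\<lambda>x y. (cal_mult A (fst x) (fst y), cal_mult B (snd x) (snd y)))\<rparr>"

definition null_alg1 :: "complex calg" where
  "null_alg1 = \<lparr>cal_carrier = UNIV, cal_add = (+), cal_scale = (*), cal_mult = (\<lambda>_ _. 0)\<rparr>"

text \<open>An element of the direct sum is a family of cosets \<open>f i\<close>, where \<open>f i\<close> is a coset
  of \<open>L^(i+1)\<close> in \<open>L^i\<close>, almost all of them zero. The component at index 0 is always the coset
  \<open>L = L/L\<close>, so the sum effectively starts at index 1. Sums of sets are elementwise
  (\<^const>\<open>plus\<close> from \<open>Set_Algebras\<close>). Adding the subspace \<open>L^(k+1)\<close> turns a set of
  representatives, all congruent modulo \<open>L^(k+1)\<close>, into their coset; in particular the empty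
  sum \<open>{0}\<close> and the set of multiples by the scalar 0 become the zero coset.\<close>

definition gr_alg ::
  "(complex \<Rightarrow> 'a::ab_group_add \<Rightarrow> 'a) \<Rightarrow> ('a \<Rightarrow> 'a \<Rightarrow> 'a) \<Rightarrow> (nat \<Rightarrow> 'a set) calg" where
  "gr_alg scale br = \<lparr>
     cal_carrier = {f. (\<forall>i. \<exists>x\<in>lcs scale br i. f i = x +o lcs scale br (i + 1)) \<and>
                       finite {i. f i \<noteq> lcs scale br (i + 1)}},
     cal_add = (\<lambda>f g i. f i + g i),
     cal_scale = (\<lambda>c f i. scale c ` f i + lcs scale br (i + 1)),
     cal_mult = (\<lambda>f g k.
       (\<Sum>i\<in>{1..<k}. {br x y | x y. x \<in> f i \<and> y \<in> g (k - i)}) + lcs scale br (k + 1))\<rparr>"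

text \<open>Vectors are coordinate functions with respect to the basis \<open>e_1, ..., e_n\<close>.\<close>

definition unit_fun :: "nat \<Rightarrow> nat \<Rightarrow> complex" where
  "unit_fun i = (\<lambda>m. if m = i then 1 else 0)"

definition kf5_table :: "nat \<Rightarrow> nat \<Rightarrow> nat \<Rightarrow> nat \<Rightarrow> complex" where
  "kf5_table n i j =
     (if j = 1 \<and> 1 \<le> i \<and> i \<le> n - 3 then unit_fun (i + 1)
      else if i = 1 \<and> j = n - 1 then (\<lambda>m. unit_fun 2 m + unit_fun n m)
      else if j = n - 1 \<and> 2 \<le> i \<and> i \<le> n - 3 then unit_fun (i + 1)
      else (\<lambda>_. 0))"

definition KF5 :: "nat \<Rightarrow> (nat \<Rightarrow> complex) calg" where
  "KF5 n = \<lparr>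
     cal_carrier = {v. \<forall>i. i \<notin> {1..n} \<longrightarrow> v i = 0},
     cal_add = (\<lambda>v w i. v i + w i),
     cal_scale = (\<lambda>c v i. c * v i),
     cal_mult = (\<lambda>v w m. \<Sum>i\<in>{1..n}. \<Sum>j\<in>{1..n}. v i * w j * kf5_table n i j m)\<rparr>"

end

theory Submission
  imports Defs
begin

text \<open>A gradation of length \<open>n + 1\<close> has one-dimensional components, so it is given by a homogeneous
  basis, and the descending central sequence is spanned by homogeneous elements. The multiplication
  of \<open>KF\<^sub>5 \<oplus> \<complex>\<close> modulo the central filtration forces exactly one basis
  element \<open>x\<close>, of degree \<open>a\<close>, to have a nonzero \<open>e\<^sub>1\<close>-coordinate, and some other
  basis element \<open>y\<close>, of degree \<open>b\<close>, to have a nonzero \<open>e\<^bsub>n-1\<^esub>\<close>-coordinate. Then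
  \<open>y\<close>, \<open>[x, x]\<close> and the iterated products \<open>[[x, y], \<dots>, y]\<close> are nonzero, and their
  position in the filtration shows that the \<open>n\<close> degrees \<open>a + i b\<close> (\<open>0 \<le> i \<le> n - 3\<close>),
  \<open>b\<close>, \<open>2 a\<close> are pairwise distinct. For \<open>n \<ge> 6\<close> they do not fit into an interval
  of \<open>n + 1\<close> integers.\<close>

section \<open>The descending central sequence and the associated graded algebra\<close>

declare lcs.simps(3) [simp del]

context leibniz_algebra
begin

abbreviation C :: "nat \<Rightarrow> 'a set" where
  "C \<equiv> lcs scale br"

lemma br_zero_left [simp]: "br 0 y = 0"
  using br_add_left[of 0 0 y] by simp

lemma br_zero_right [simp]: "br x 0 = 0"
  using br_add_right[of x 0 0] by simp

lemma br_diff_left: "br (x - y) z = br x z - br y z"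
  using br_add_left[of "x - y" y z] by simp

lemma br_sum_left: "br (sum f A) y = (\<Sum>i\<in>A. br (f i) y)"
  by (induction A rule: infinite_finite_induct) (auto simp: br_add_left)

lemma br_sum_right: "br x (sum f A) = (\<Sum>i\<in>A. br x (f i))"
  by (induction A rule: infinite_finite_induct) (auto simp: br_add_right)

lemma subspace_br_left: "subspace T \<Longrightarrow> subspace {x. br x y \<in> T}"
  by (auto simp: subspace_def br_add_left br_scale_left)

lemma subspace_br_right: "subspace T \<Longrightarrow> subspace {y. br x y \<in> T}"
  by (auto simp: subspace_def br_add_right br_scale_right)

lemma subspace_lcs [simp]: "subspace (C i)"
  by (induction i rule: induct_nat_012) (auto simp: lcs.simps(3))

lemma lcs_zero [simp]: "0 \<in> C i"
  by (simp add: subspace_0)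

lemma lcs_br: "x \<in> C i \<Longrightarrow> 1 \<le> i \<Longrightarrow> br x y \<in> C (Suc i)"
  by (cases i) (auto simp: lcs.simps(3) intro: span_base)

lemma lcs_Suc_subset: "C (Suc i) \<subseteq> C i"
proof (induction i)
  case (Suc i)
  then show ?case
    by (cases i) (auto simp: lcs.simps(3) intro!: span_mono)
qed simp

lemma lcs_antimono: "i \<le> j \<Longrightarrow> C j \<subseteq> C i"
  by (rule lift_Suc_antimono_le[of C]) (use lcs_Suc_subset in auto)

text \<open>The sequence is built from right multiplications, and the Leibniz identity turns
  \<open>br x (br u z)\<close> into a difference of two iterated right products. The index
  \<open>i\<close> stays free in the induction because \<open>br x z\<close> lies one step deeper
  than \<open>x\<close>.\<close>

lemma lcs_br_lcs:
  assumes "x \<in> C i" "y \<in> C j" "1 \<le> i" "1 \<le> j"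
  shows "br x y \<in> C (i + j)"
  using assms(4,1,2,3)
proof (induction j arbitrary: i x y rule: dec_induct)
  case base
  then show ?case using lcs_br by simp
next
  case (step j)
  obtain j' where j': "j = Suc j'" using step.hyps by (cases j) auto
  have "C (Suc j) \<subseteq> {y. br x y \<in> C (i + Suc j)}"
    unfolding j' lcs.simps(3)
  proof (rule span_minimal)
    show "subspace {y. br x y \<in> C (i + Suc (Suc j'))}"
      by (rule subspace_br_right) simp
    show "{br u z |u z. u \<in> C (Suc j')} \<subseteq> {y. br x y \<in> C (i + Suc (Suc j'))}"
    proof clarify
      fix u z assume u: "u \<in> C (Suc j')"
      have "br (br x u) z \<in> C (Suc (i + j))"
        using step.IH[of x i u] step.prems u j' by (intro lcs_br) auto
      moreover have "br (br x z) u \<in> C (Suc i + j)"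
        using step.IH[of "br x z" "Suc i" u] step.prems u j' lcs_br by auto
      ultimately show "br x (br u z) \<in> C (i + Suc (Suc j'))"
        unfolding leibniz by (intro subspace_diff) (auto simp: j')
    qed
  qed
  then show ?case using step.prems by auto
qed

lemma lcs_br_anti: "x \<in> C i \<Longrightarrow> y \<in> C j \<Longrightarrow> 1 \<le> i \<Longrightarrow> 1 \<le> j \<Longrightarrow> m \<le> i + j \<Longrightarrow> br x y \<in> C m"
  using lcs_br_lcs lcs_antimono by blast

section \<open>Well-definedness of the operations of the associated graded algebra\<close>

abbreviation "G \<equiv> gr_alg scale br"

lemma coset_eqI:
  assumes "x \<in> a +o C i" shows "a +o C i = x +o C i"
proof -
  obtain s where s: "s \<in> C i" "x = a + s" using assms by (auto simp: elt_set_plus_def)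
  have "a + t = x + (t - s)" "x + t = a + (t + s)" for t using s by (auto simp: algebra_simps)
  moreover have "t - s \<in> C i" "t + s \<in> C i" if "t \<in> C i" for t
    using s that by (auto intro: subspace_diff subspace_add)
  ultimately show ?thesis unfolding elt_set_plus_def by blast
qed

lemma gr_coset:
  assumes "f \<in> cal_carrier G" "x \<in> f i"
  shows "x \<in> C i" "f i = x +o C (Suc i)"
proof -
  obtain a where a: "a \<in> C i" "f i = a +o C (Suc i)"
    using assms(1) by (auto simp: gr_alg_def)
  show "f i = x +o C (Suc i)"
    using coset_eqI a assms(2) by metis
  show "x \<in> C i" using a assms(2) lcs_Suc_subset[of i]
    by (auto simp: elt_set_plus_def intro!: subspace_add)
qed

lemma gr_nonempty: "f \<in> cal_carrier G \<Longrightarrow> \<exists>x. x \<in> f i"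
proof -
  assume "f \<in> cal_carrier G"
  then obtain x where "f i = x +o C (Suc i)" by (auto simp: gr_alg_def)
  moreover have "x + 0 \<in> x +o C (Suc i)" by (intro set_plus_intro2) simp
  ultimately show ?thesis by auto
qed

text \<open>Nilpotency makes \<open>C i\<close> vanish for large \<open>i\<close>; the only coset
  there is the zero coset, so finite support is automatic.\<close>

lemma gr_carrierI:
  assumes "nilpotent_alg scale br" "\<And>i. \<exists>x\<in>C i. f i = x +o C (Suc i)"
  shows "f \<in> cal_carrier G"
proof -
  obtain k where k: "C k = {0}" using assms(1) by (auto simp: nilpotent_alg_def)
  have z: "C i = {0}" if "i \<ge> k" for i
    using lcs_antimono[OF that] k by auto
  have "f i = C (Suc i)" if "i \<ge> k" for i
    using assms(2)[of i] z[of i] z[of "Suc i"] that by (auto simp: elt_set_plus_def)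
  then have "{i. f i \<noteq> C (Suc i)} \<subseteq> {..<k}" by force
  then have "finite {i. f i \<noteq> C (Suc i)}" using finite_subset by blast
  then show ?thesis using assms(2) by (auto simp: gr_alg_def)
qed

text \<open>Scaling and multiplication in \<open>gr_alg\<close> yield a set of representatives plus
  a subspace; this identifies such a set with a single coset.\<close>

lemma set_plus_subset_coset:
  assumes "A \<noteq> {}" "\<And>y. y \<in> A \<Longrightarrow> y - x \<in> C i"
  shows "A + C i = x +o C i"
proof -
  have "a + s = x + ((a - x) + s)" "x + s = a + (s - (a - x))" for a s by auto
  moreover have "(a - x) + s \<in> C i" "s - (a - x) \<in> C i" if "a \<in> A" "s \<in> C i" for a s
    using assms(2) that by (auto intro: subspace_add subspace_diff)
  ultimately show ?thesis using assms(1) unfolding elt_set_plus_def set_plus_def by blast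
qed

lemma gr_add_closed:
  assumes "nilpotent_alg scale br" "f \<in> cal_carrier G" "g \<in> cal_carrier G"
  shows "cal_add G f g \<in> cal_carrier G"
proof (rule gr_carrierI[OF assms(1)])
  fix i
  obtain x y where xy: "x \<in> f i" "y \<in> g i" using gr_nonempty assms by metis
  note c = gr_coset[OF assms(2) xy(1)] gr_coset[OF assms(3) xy(2)]
  have "f i + g i = (x + y) +o C (Suc i)"
  proof -
    have "C (Suc i) + C (Suc i) = C (Suc i)"
      by (auto simp: set_plus_def intro: subspace_add)
         (metis add_0 lcs_zero)
    then show ?thesis using c by (metis set_plus_rearrange)
  qed
  then show "\<exists>x\<in>C i. cal_add G f g i = x +o C (Suc i)"
    using c by (intro bexI[of _ "x + y"]) (auto simp: gr_alg_def intro: subspace_add)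
qed

lemma gr_scale_closed:
  assumes "nilpotent_alg scale br" "f \<in> cal_carrier G"
  shows "cal_scale G c f \<in> cal_carrier G"
proof (rule gr_carrierI[OF assms(1)])
  fix i
  obtain x where x: "x \<in> f i" using gr_nonempty assms by metis
  note c = gr_coset[OF assms(2) x]
  have [simp]: "scale c b \<in> C (Suc i)" if "b \<in> C (Suc i)" for b
    using that subspace_lcs by (rule subspace_scale[rotated])
  have "scale c ` f i + C (Suc i) = scale c x +o C (Suc i)"
    by (rule set_plus_subset_coset)
       (use x c(2) in \<open>auto simp: elt_set_plus_def scale_right_distrib intro: subspace_scale lcs_zero\<close>)
  then show "\<exists>x\<in>C i. cal_scale G c f i = x +o C (Suc i)"
    using c by (intro bexI[of _ "scale c x"]) (auto simp: gr_alg_def intro: subspace_scale)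
qed

text \<open>Another choice of representatives changes each summand by an element of
  \<open>C (Suc k)\<close> only, so any choice computes the product.\<close>

lemma gr_mult_coset:
  assumes "f \<in> cal_carrier G" "g \<in> cal_carrier G"
    "\<And>i. x i \<in> f i" "\<And>i. y i \<in> g i"
  shows "cal_mult G f g k = (\<Sum>i\<in>{1..<k}. br (x i) (y (k - i))) +o C (Suc k)"
    and "(\<Sum>i\<in>{1..<k}. br (x i) (y (k - i))) \<in> C k"
proof -
  have mem: "br u v \<in> C k" if "i \<in> {1..<k}" "u \<in> C i" "v \<in> C (k - i)" for i u v
    using lcs_br_lcs[OF that(2,3)] that(1) by (simp add: le_diff_conv2)
  show "(\<Sum>i\<in>{1..<k}. br (x i) (y (k - i))) \<in> C k"
    using gr_coset assms mem by (intro subspace_sum) auto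
  have diff: "br u v - br (x i) (y (k - i)) \<in> C (Suc k)"
    if i: "i \<in> {1..<k}" and "u \<in> f i" "v \<in> g (k - i)" for i u v
  proof -
    have "u \<in> x i +o C (Suc i)" "v \<in> y (k - i) +o C (Suc (k - i))"
      using that(2,3) gr_coset(2)[OF assms(1,3), of i] gr_coset(2)[OF assms(2,4), of "k - i"] by auto
    then obtain s t where s: "s \<in> C (Suc i)" "u = x i + s"
      and t: "t \<in> C (Suc (k - i))" "v = y (k - i) + t"
      by (auto simp: elt_set_plus_def)
    have "br s v \<in> C (Suc i + (k - i))"
      using i gr_coset(1)[OF assms(2) that(3)] s by (intro lcs_br_lcs) auto
    moreover have "br (x i) t \<in> C (i + Suc (k - i))"
      using i gr_coset(1)[OF assms(1) assms(3)] t by (intro lcs_br_lcs) auto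
    moreover have "br u v - br (x i) (y (k - i)) = br s v + br (x i) t"
      by (simp add: s t br_add_left br_add_right)
    moreover have "Suc i + (k - i) = Suc k" "i + Suc (k - i) = Suc k" using i by auto
    ultimately show ?thesis by (simp add: subspace_add)
  qed
  have eq: "cal_mult G f g k
      = (\<Sum>i\<in>{1..<k}. {br u v | u v. u \<in> f i \<and> v \<in> g (k - i)}) + C (Suc k)"
    by (simp add: gr_alg_def)
  show "cal_mult G f g k = (\<Sum>i\<in>{1..<k}. br (x i) (y (k - i))) +o C (Suc k)"
    unfolding eq
  proof (rule set_plus_subset_coset)
    show "(\<Sum>i\<in>{1..<k}. {br u v | u v. u \<in> f i \<and> v \<in> g (k - i)}) \<noteq> {}"
      unfolding set_sum_alt[OF finite_atLeastLessThan] using assms(3,4)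
      by (auto intro!: exI[of _ "\<lambda>i. br (x i) (y (k - i))"])
    fix w assume "w \<in> (\<Sum>i\<in>{1..<k}. {br u v | u v. u \<in> f i \<and> v \<in> g (k - i)})"
    then obtain s where s: "w = sum s {1..<k}"
      "\<forall>i\<in>{1..<k}. s i \<in> {br u v | u v. u \<in> f i \<and> v \<in> g (k - i)}"
      unfolding set_sum_alt[OF finite_atLeastLessThan] by auto
    have "s i - br (x i) (y (k - i)) \<in> C (Suc k)" if i: "i \<in> {1..<k}" for i
    proof -
      obtain u v where "s i = br u v" "u \<in> f i" "v \<in> g (k - i)" using bspec[OF s(2) i] by auto
      then show ?thesis using diff[OF i] by simp
    qed
    then show "w - (\<Sum>i\<in>{1..<k}. br (x i) (y (k - i))) \<in> C (Suc k)"
      unfolding s(1) sum_subtractf[symmetric] by (intro subspace_sum) auto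
  qed
qed

lemma gr_mult_closed:
  assumes "nilpotent_alg scale br" "f \<in> cal_carrier G" "g \<in> cal_carrier G"
  shows "cal_mult G f g \<in> cal_carrier G"
proof (rule gr_carrierI[OF assms(1)])
  fix k
  obtain x y where "\<And>i. x i \<in> f i" "\<And>i. y i \<in> g i" using gr_nonempty assms by metis
  then show "\<exists>x\<in>C k. cal_mult G f g k = x +o C (Suc k)"
    using gr_mult_coset[OF assms(2,3), of x y k] by (intro bexI) auto
qed

end

section \<open>Lifting the multiplication table\<close>

lemma kf5_table_last:
  assumes "n \<ge> 6" "1 \<le> i"
  shows "kf5_table n i (n - 1) m = (if i = m - 1 \<and> 2 \<le> m \<and> m \<le> n - 2 then 1 else 0)
    + (if i = 1 \<and> m = n then 1 else 0)"
proof (cases "i = 1")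
  case True
  then show ?thesis using assms by (auto simp: kf5_table_def unit_fun_def)
next
  case False
  then show ?thesis using assms by (auto simp: kf5_table_def unit_fun_def)
qed

text \<open>Only the columns of e_1 and e_(n-1) in the table are nonzero. Both shift e_i to e_(i+1)
  for i up to n - 3, and the second adds e_n to the image of e_1.\<close>

lemma KF5_mult:
  assumes "n \<ge> 6"
  shows "cal_mult (KF5 n) v w = (\<lambda>m. (w 1 + w (n - 1)) * (if 2 \<le> m \<and> m \<le> n - 2 then v (m - 1) else 0)
    + (if m = n then w (n - 1) * v 1 else 0))"
proof
  fix m
  have 1: "(\<Sum>j\<in>{1..n}. v i * w j * kf5_table n i j m)
      = v i * w 1 * kf5_table n i 1 m + v i * w (n - 1) * kf5_table n i (n - 1) m" for i
  proof -
    have "(\<Sum>j\<in>{1..n}. v i * w j * kf5_table n i j m)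
        = (\<Sum>j\<in>{1, n - 1}. v i * w j * kf5_table n i j m)"
      using assms by (intro sum.mono_neutral_right) (auto simp: kf5_table_def)
    then show ?thesis using assms by simp
  qed
  have 2: "(\<Sum>i\<in>{1..n}. v i * w 1 * kf5_table n i 1 m)
      = w 1 * (if 2 \<le> m \<and> m \<le> n - 2 then v (m - 1) else 0)"
  proof -
    have "(\<Sum>i\<in>{1..n}. v i * w 1 * kf5_table n i 1 m)
      = (\<Sum>i\<in>{1..n}. if i = m - 1 then w 1 * (if 2 \<le> m \<and> m \<le> n - 2 then v i else 0) else 0)"
      using assms by (intro sum.cong) (auto simp: kf5_table_def unit_fun_def)
    also have "\<dots> = w 1 * (if 2 \<le> m \<and> m \<le> n - 2 then v (m - 1) else 0)"
      using assms by (auto simp: sum.delta)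
    finally show ?thesis .
  qed
  have 3: "(\<Sum>i\<in>{1..n}. v i * w (n - 1) * kf5_table n i (n - 1) m)
      = w (n - 1) * (if 2 \<le> m \<and> m \<le> n - 2 then v (m - 1) else 0)
        + (if m = n then w (n - 1) * v 1 else 0)"
  proof -
    have "(\<Sum>i\<in>{1..n}. v i * w (n - 1) * kf5_table n i (n - 1) m)
      = (\<Sum>i\<in>{1..n}. (if i = m - 1 then w (n - 1) * (if 2 \<le> m \<and> m \<le> n - 2 then v i else 0) else 0)
          + (if i = 1 then if m = n then w (n - 1) * v i else 0 else 0))"
      using assms by (intro sum.cong) (auto simp: kf5_table_last[simplified])
    also have "\<dots> = w (n - 1) * (if 2 \<le> m \<and> m \<le> n - 2 then v (m - 1) else 0)
        + (if m = n then w (n - 1) * v 1 else 0)"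
      using assms unfolding sum.distrib by (auto simp: sum.delta)
    finally show ?thesis .
  qed
  have "cal_mult (KF5 n) v w m = (\<Sum>i\<in>{1..n}. \<Sum>j\<in>{1..n}. v i * w j * kf5_table n i j m)"
    by (simp add: KF5_def)
  also have "\<dots> = w 1 * (if 2 \<le> m \<and> m \<le> n - 2 then v (m - 1) else 0) +
      (w (n - 1) * (if 2 \<le> m \<and> m \<le> n - 2 then v (m - 1) else 0)
        + (if m = n then w (n - 1) * v 1 else 0))"
    unfolding 1 sum.distrib 2 3 ..
  finally show "cal_mult (KF5 n) v w m
      = (w 1 + w (n - 1)) * (if 2 \<le> m \<and> m \<le> n - 2 then v (m - 1) else 0)
        + (if m = n then w (n - 1) * v 1 else 0)"
    by (simp add: algebra_simps)
qed

text \<open>Here \<open>W j\<close> lifts \<open>e\<^bsub>j+1\<^esub>\<close> (and \<open>0\<close> for \<open>j \<ge> n - 2\<close>), \<open>Q\<close> lifts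
  \<open>e\<^bsub>n-1\<^esub>\<close>, \<open>R\<close> lifts the generator of the summand \<open>\<complex>\<close>, and
  \<open>[W 0, Q] - W 1\<close> lifts \<open>e\<^sub>n\<close>.\<close>

locale kf5_frame = leibniz_algebra +
  fixes n :: nat and W :: "nat \<Rightarrow> 'a" and Q R :: 'a
  assumes n6: "n \<ge> 6"
    and nilp: "nilpotent_alg scale br"
    and W_Suc: "W (Suc j) = br (W j) (W 0)"
    and W_last: "W (n - 2) \<in> C n"
    and generators: "x \<in> span (insert (W 0) (insert Q (insert R (C 2))))"
    and Q_br: "br Q y \<in> C 3"
    and R_br: "br R y \<in> C 3"
    and W_br_R: "br (W j) R \<in> C (j + 3)"
    and W_br_Q: "1 \<le> j \<Longrightarrow> br (W j) Q - W (Suc j) \<in> C (j + 3)"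
    and Z_br: "br (br (W 0) Q - W 1) y \<in> C 4"

locale gr_model = leibniz_algebra +
  fixes n :: nat and \<phi> :: "(nat \<Rightarrow> 'a set) \<Rightarrow> (nat \<Rightarrow> complex) \<times> complex"
  assumes n6: "n \<ge> 6" and nilp: "nilpotent_alg scale br"
    and bij: "bij_betw \<phi> (cal_carrier (gr_alg scale br)) (cal_carrier (calg_sum (KF5 n) null_alg1))"
    and iso_add: "\<And>x y. x \<in> cal_carrier (gr_alg scale br) \<Longrightarrow> y \<in> cal_carrier (gr_alg scale br) \<Longrightarrow>
       \<phi> (cal_add (gr_alg scale br) x y) = cal_add (calg_sum (KF5 n) null_alg1) (\<phi> x) (\<phi> y)"
    and iso_mult: "\<And>x y. x \<in> cal_carrier (gr_alg scale br) \<Longrightarrow> y \<in> cal_carrier (gr_alg scale br) \<Longrightarrow>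
       \<phi> (cal_mult (gr_alg scale br) x y) = cal_mult (calg_sum (KF5 n) null_alg1) (\<phi> x) (\<phi> y)"
    and iso_scale: "\<And>c x. x \<in> cal_carrier (gr_alg scale br) \<Longrightarrow>
       \<phi> (cal_scale (gr_alg scale br) c x) = cal_scale (calg_sum (KF5 n) null_alg1) c (\<phi> x)"
begin

section \<open>The model algebra in coordinates and the inverse isomorphism\<close>

definition K :: "((nat \<Rightarrow> complex) \<times> complex) set" where
  "K = {u. \<forall>i. i \<notin> {1..n} \<longrightarrow> fst u i = 0}"

definition add where "add u v = (\<lambda>i. fst u i + fst v i :: complex, snd u + snd v :: complex)"
definition scl where "scl c u = (\<lambda>i. c * fst u i :: complex, c * snd u :: complex)"
definition mul :: "(nat \<Rightarrow> complex) \<times> complex \<Rightarrow> _" where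
  "mul u v = (\<lambda>m. (fst v 1 + fst v (n - 1)) * (if 2 \<le> m \<and> m \<le> n - 2 then fst u (m - 1) else 0)
    + (if m = n then fst v (n - 1) * fst u 1 else 0), 0::complex)"

lemma model_simps:
  "cal_carrier (calg_sum (KF5 n) null_alg1) = K"
  "cal_add (calg_sum (KF5 n) null_alg1) = add"
  "cal_scale (calg_sum (KF5 n) null_alg1) = scl"
  "cal_mult (calg_sum (KF5 n) null_alg1) = mul"
  by (auto simp: calg_sum_def KF5_mult[OF n6] null_alg1_def K_def add_def scl_def mul_def fun_eq_iff)
     (auto simp: KF5_def)

definition \<psi> where "\<psi> = inv_into (cal_carrier G) \<phi>"

lemma psi_closed: "u \<in> K \<Longrightarrow> \<psi> u \<in> cal_carrier G"
  unfolding \<psi>_def using bij by (metis bij_betw_def inv_into_into model_simps(1))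

lemma phi_psi: "u \<in> K \<Longrightarrow> \<phi> (\<psi> u) = u"
  unfolding \<psi>_def using bij by (metis bij_betw_inv_into_right model_simps(1))

lemma psi_phi: "f \<in> cal_carrier G \<Longrightarrow> \<psi> (\<phi> f) = f"
  unfolding \<psi>_def using bij by (metis bij_betw_inv_into_left)

lemma phi_closed: "f \<in> cal_carrier G \<Longrightarrow> \<phi> f \<in> K"
  using bij unfolding model_simps(1) by (auto simp: bij_betw_def)

lemma K_closed [simp]:
  "u \<in> K \<Longrightarrow> v \<in> K \<Longrightarrow> add u v \<in> K" "u \<in> K \<Longrightarrow> scl c u \<in> K" "mul u v \<in> K"
  using n6 by (auto simp: K_def add_def scl_def mul_def)

lemma psi_add: "u \<in> K \<Longrightarrow> v \<in> K \<Longrightarrow> \<psi> (add u v) = cal_add G (\<psi> u) (\<psi> v)"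
  using iso_add[of "\<psi> u" "\<psi> v"] psi_closed phi_psi psi_phi gr_add_closed[OF nilp]
  unfolding model_simps by metis

lemma psi_scl: "u \<in> K \<Longrightarrow> \<psi> (scl c u) = cal_scale G c (\<psi> u)"
  using iso_scale[of "\<psi> u" c] psi_closed phi_psi psi_phi gr_scale_closed[OF nilp]
  unfolding model_simps by metis

lemma psi_mul: "u \<in> K \<Longrightarrow> v \<in> K \<Longrightarrow> \<psi> (mul u v) = cal_mult G (\<psi> u) (\<psi> v)"
  using iso_mult[of "\<psi> u" "\<psi> v"] psi_closed phi_psi psi_phi gr_mult_closed[OF nilp]
  unfolding model_simps by metis

section \<open>Representatives of the components of \<open>\<psi> u\<close>\<close>

lemma rep_ex: "u \<in> K \<Longrightarrow> \<exists>x. x \<in> \<psi> u i"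
  using gr_nonempty psi_closed by blast

lemma rep_diff: "u \<in> K \<Longrightarrow> x \<in> \<psi> u i \<Longrightarrow> y \<in> \<psi> u i \<Longrightarrow> x - y \<in> C (Suc i)"
  using gr_coset(2)[OF psi_closed, of u y i] by (auto simp: elt_set_plus_def)

lemma rep_shift: "u \<in> K \<Longrightarrow> x \<in> \<psi> u i \<Longrightarrow> x - y \<in> C (Suc i) \<Longrightarrow> y \<in> \<psi> u i"
  using gr_coset(2)[OF psi_closed, of u x i] subspace_neg[OF subspace_lcs, of "x - y" "Suc i"]
  by (auto simp: elt_set_plus_def intro!: bexI[of _ "y - x"])

lemma rep_add: "u \<in> K \<Longrightarrow> v \<in> K \<Longrightarrow> x \<in> \<psi> u i \<Longrightarrow> y \<in> \<psi> v i \<Longrightarrow> x + y \<in> \<psi> (add u v) i"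
  by (simp add: psi_add) (auto simp: gr_alg_def)

lemma rep_scl: "u \<in> K \<Longrightarrow> x \<in> \<psi> u i \<Longrightarrow> scale c x \<in> \<psi> (scl c u) i"
  using set_plus_intro[of "scale c x" "scale c ` \<psi> u i" 0 "C (Suc i)"]
  by (simp add: psi_scl) (auto simp: gr_alg_def)

text \<open>The isomorphism need not respect the gradings; \<open>low m u\<close> says that the element
  corresponding to \<open>u\<close> has no component of degree less than \<open>m\<close>.\<close>

definition low :: "nat \<Rightarrow> (nat \<Rightarrow> complex) \<times> complex \<Rightarrow> bool" where
  "low m u \<longleftrightarrow> u \<in> K \<and> (\<forall>i<m. 0 \<in> \<psi> u i)"

lemma low_K: "low m u \<Longrightarrow> u \<in> K"
  by (simp add: low_def)

text \<open>The component of index 0 is a coset of \<open>C 1\<close>, which is the whole algebra,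
  so it always contains \<open>0\<close>.\<close>

lemma low_1: "u \<in> K \<Longrightarrow> low (Suc 0) u"
  using rep_ex[of u 0] rep_shift[of u _ 0 0] by (auto simp: low_def)

lemma low_add: "low m u \<Longrightarrow> low m v \<Longrightarrow> low m (add u v)"
  using rep_add[of u v 0 _ 0] by (auto simp: low_def)

lemma low_scl: "low m u \<Longrightarrow> low m (scl c u)"
  using rep_scl[of u 0 _ c] by (auto simp: low_def)

text \<open>Leading term of a product: \<open>u\<close> has no component below \<open>m\<close> and
  products only involve components of \<open>v\<close> from degree 1 on, so in degree
  \<open>Suc m\<close> one summand survives and all lower degrees vanish.\<close>

lemma rep_mul:
  assumes "low m u" "v \<in> K" "m \<ge> 1" "x \<in> \<psi> u m" "y \<in> \<psi> v 1"
  shows "br x y \<in> \<psi> (mul u v) (Suc m)" "low (Suc m) (mul u v)"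
proof -
  have u: "u \<in> K" using assms(1) by (rule low_K)
  obtain f where f: "\<And>i. f i \<in> \<psi> u i" using rep_ex[OF u] by metis
  obtain g where g: "\<And>i. g i \<in> \<psi> v i" using rep_ex[OF assms(2)] by metis
  \<comment> \<open>\<open>X\<close> vanishes below \<open>m\<close>, which \<open>low m u\<close>
    permits; \<open>X\<close> and \<open>Y\<close> take the prescribed values \<open>x\<close> and
    \<open>y\<close> in the two degrees that matter.\<close>
  define X where "X = (\<lambda>i. if i < m then 0 else if i = m then x else f i)"
  define Y where "Y = (\<lambda>i. if i = 1 then y else g i)"
  have X: "\<And>i. X i \<in> \<psi> u i" and Y: "\<And>i. Y i \<in> \<psi> v i"
    using assms f g by (auto simp: X_def Y_def low_def)
  have prod: "(\<Sum>i\<in>{1..<k}. br (X i) (Y (k - i))) \<in> \<psi> (mul u v) k" for k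
    unfolding psi_mul[OF u assms(2)]
    using gr_mult_coset(1)[OF psi_closed[OF u] psi_closed[OF assms(2)] X Y, of k]
      set_plus_intro2[of 0 "C (Suc k)"] by fastforce
  have "(\<Sum>i\<in>{1..<Suc m}. br (X i) (Y (Suc m - i))) = (\<Sum>i\<in>{m}. br (X i) (Y (Suc m - i)))"
    using assms(3) by (intro sum.mono_neutral_right) (auto simp: X_def)
  then show "br x y \<in> \<psi> (mul u v) (Suc m)"
    using prod[of "Suc m"] by (simp add: X_def Y_def)
  have "(\<Sum>i\<in>{1..<k}. br (X i) (Y (k - i))) = 0" if "k \<le> m" for k
    using that by (intro sum.neutral) (auto simp: X_def)
  then show "low (Suc m) (mul u v)"
    using prod by (auto simp: low_def less_Suc_eq_le) metis
qed

text \<open>Since \<open>C 1\<close> is the whole algebra, every \<open>y\<close> gives an element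
  of the graded algebra concentrated in degree 1; its image under \<open>\<phi>\<close> is the
  required \<open>u\<close>.\<close>

lemma rep_first:
  obtains u where "u \<in> K" "y \<in> \<psi> u 1"
proof -
  define f where "f = (\<lambda>i. (if i = 1 then y else 0) +o C (Suc i))"
  have f: "f \<in> cal_carrier G"
    by (rule gr_carrierI[OF nilp], rule_tac x = "if i = 1 then y else 0" in bexI) (auto simp: f_def)
  have "y \<in> f 1" using set_plus_intro2[of 0 "C (Suc 1)" y] by (simp add: f_def)
  then show ?thesis using that[of "\<phi> f"] phi_closed[OF f] psi_phi[OF f] by simp
qed

definition "zer = (\<lambda>i::nat. 0::complex, 0::complex)"

lemma zer_K [simp]: "zer \<in> K" by (simp add: zer_def K_def)

text \<open>Scaling \<open>zer\<close> by the number 0 gives \<open>zer\<close> again, so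
  \<open>0\<close> represents each of its components, and representatives of one component differ by
  an element of \<open>C (Suc i)\<close>.\<close>

lemma rep_zer: "x \<in> \<psi> zer i \<Longrightarrow> x \<in> C (Suc i)"
proof -
  assume x: "x \<in> \<psi> zer i"
  have "scl 0 zer = zer" by (simp add: scl_def zer_def)
  then have "0 \<in> \<psi> zer i" using rep_scl[OF zer_K x, of 0] by simp
  then show ?thesis using rep_diff[OF zer_K x] by fastforce
qed

text \<open>This is e_(j+1) up to e_(n-2) and zero afterwards, so that right multiplication by e_1
  raises the index without exception.\<close>

definition chain :: "nat \<Rightarrow> (nat \<Rightarrow> complex) \<times> complex" where
  "chain j = (\<lambda>m. if m = Suc j \<and> Suc j \<le> n - 2 then 1 else 0, 0)"
definition q where "q = (unit_fun (n - 1), 0::complex)"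
definition r where "r = (\<lambda>i::nat. 0::complex, 1::complex)"
definition z where "z = (unit_fun n, 0::complex)"

lemma gens_K [simp]: "chain j \<in> K" "q \<in> K" "r \<in> K" "z \<in> K"
  using n6 by (auto simp: K_def chain_def q_def r_def z_def unit_fun_def)

lemma mul_gens:
  "mul (chain j) (chain 0) = chain (Suc j)"
  "1 \<le> j \<Longrightarrow> mul (chain j) q = chain (Suc j)"
  "mul u r = zer" "mul r u = zer" "mul q u = zer" "mul z u = zer"
  "add (mul (chain 0) q) (scl (- 1) (chain 1)) = z"
  using n6 by (auto simp: mul_def chain_def q_def r_def z_def zer_def add_def scl_def unit_fun_def fun_eq_iff)

text \<open>The three generators are split off. What remains is a product plus a multiple of e_n,
  hence without component in degree 1.\<close>

lemma K_decompose:
  assumes "u \<in> K"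
  shows "\<exists>w\<in>K. u = add (add (scl (fst u 1) (chain 0)) (add (scl (fst u (n - 1)) q) (scl (snd u) r)))
     (add (mul w (chain 0)) (scl (fst u n) z))"
proof (rule bexI)
  \<comment> \<open>The coordinates 2 to n - 2 are moved down by one; right multiplication by e_1
    moves them back.\<close>
  let ?w = "(\<lambda>m. if 1 \<le> m \<and> m \<le> n - 3 then fst u (Suc m) else 0, 0::complex)"
  show "?w \<in> K" by (auto simp: K_def)
  have u0: "fst u m = 0" if "m = 0 \<or> m > n" for m using assms that by (auto simp: K_def)
  show "u = add (add (scl (fst u 1) (chain 0)) (add (scl (fst u (n - 1)) q) (scl (snd u) r)))
     (add (mul ?w (chain 0)) (scl (fst u n) z))"
  proof (rule prod_eqI; (rule ext)?)
    fix m
    obtain k where k: "n = k + 6" using n6 by (metis add.commute le_Suc_ex)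
    consider "m = 0" | "m = 1" | "2 \<le> m \<and> m \<le> n - 2" | "m = n - 1" | "m = n" | "m > n" by linarith
    then show "fst u m = fst (add (add (scl (fst u 1) (chain 0)) (add (scl (fst u (n - 1)) q) (scl (snd u) r)))
     (add (mul ?w (chain 0)) (scl (fst u n) z))) m"
      unfolding add_def scl_def mul_def chain_def q_def r_def z_def unit_fun_def fst_conv snd_conv
      by cases (use u0[of m] in \<open>auto simp: k\<close>)
  qed (auto simp: add_def scl_def mul_def chain_def q_def r_def z_def)
qed

lemma low_mul: "low m u \<Longrightarrow> v \<in> K \<Longrightarrow> m \<ge> 1 \<Longrightarrow> low (Suc m) (mul u v)"
  using rep_mul(2) rep_ex low_K by metis

lemma low_chain: "low (Suc j) (chain j)"
proof (induction j)
  case 0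
  then show ?case using low_1[of "chain 0"] by simp
next
  case (Suc j)
  then show ?case using low_mul[of "Suc j" "chain j" "chain 0"] by (simp add: mul_gens)
qed

text \<open>e_n is [e_1, e_(n-1)] - e_2, and both terms are products.\<close>

lemma low_z: "low 2 z"
proof -
  have "low (Suc 1) (mul (chain 0) q)" by (rule low_mul) (simp_all add: low_1)
  moreover have "low (Suc 1) (chain 1)" by (rule low_chain)
  ultimately have "low (Suc 1) (add (mul (chain 0) q) (scl (- 1) (chain 1)))"
    by (intro low_add low_scl)
  then show ?thesis unfolding mul_gens(7) by (simp add: numeral_2_eq_2)
qed

text \<open>A zero product in the model becomes a product that falls one step deeper than the
  filtration alone guarantees.\<close>

lemma br_rep_zer:
  "low m u \<Longrightarrow> v \<in> K \<Longrightarrow> m \<ge> 1 \<Longrightarrow> x \<in> \<psi> u m \<Longrightarrow> y \<in> \<psi> v 1 \<Longrightarrow> mul u v = zer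
    \<Longrightarrow> br x y \<in> C (Suc (Suc m))"
  using rep_mul(1)[of m u v x y] rep_zer by auto

text \<open>The lifts are degree 1 representatives of e_1, e_(n-1) and the generator of the null
  summand; each relation of the model then holds up to the next term of the central
  sequence.\<close>

theorem ex_frame: "\<exists>W Q R. kf5_frame scale br n W Q R"
proof -
  obtain P Q R where P: "P \<in> \<psi> (chain 0) 1" and Q: "Q \<in> \<psi> q 1" and R: "R \<in> \<psi> r 1"
    using rep_ex gens_K by metis
  \<comment> \<open>Iterating in the algebra itself makes \<open>W_Suc\<close> an exact identity
    instead of a congruence.\<close>
  define W where "W j = ((\<lambda>x. br x P) ^^ j) P" for j
  have W0: "W 0 = P" and WS: "W (Suc j) = br (W j) P" for j
    by (simp_all add: W_def)
  have W: "W j \<in> \<psi> (chain j) (Suc j)" for j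
  proof (induction j)
    case 0
    then show ?case using P W0 by simp
  next
    case (Suc j)
    then show ?case using rep_mul(1)[OF low_chain[of j] gens_K(1)[of 0] _ Suc P]
      by (simp add: mul_gens WS)
  qed
  have Z: "br P Q - W 1 \<in> \<psi> z 2"
  proof -
    have "br P Q \<in> \<psi> (mul (chain 0) q) (Suc 1)"
      by (rule rep_mul(1)) (simp_all add: low_1 P[simplified] Q[simplified])
    moreover have "scale (- 1) (W 1) \<in> \<psi> (scl (- 1) (chain 1)) (Suc 1)"
      by (rule rep_scl[OF gens_K(1) W])
    ultimately have "br P Q + scale (- 1) (W 1) \<in> \<psi> (add (mul (chain 0) q) (scl (- 1) (chain 1))) (Suc 1)"
      by (intro rep_add) auto
    then show ?thesis unfolding mul_gens(7) by (simp add: numeral_2_eq_2)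
  qed
  show ?thesis
  proof (intro exI, unfold_locales)
    show "n \<ge> 6" "nilpotent_alg scale br" by (fact n6 nilp)+
    show "W (Suc j) = br (W j) (W 0)" for j by (simp add: W0 WS)
    \<comment> \<open>The chain ends at e_(n-2), so the next lift represents zero in degree n - 1
      and gains one filtration step.\<close>
    have "chain (n - 2) = zer" by (auto simp: chain_def zer_def)
    then have "W (n - 2) \<in> C (Suc (Suc (n - 2)))" using W[of "n - 2"] rep_zer by simp
    moreover have "Suc (Suc (n - 2)) = n" using n6 by simp
    ultimately show "W (n - 2) \<in> C n" by simp
    show "br Q y \<in> C 3" for y
    proof -
      obtain u where "u \<in> K" "y \<in> \<psi> u 1" by (rule rep_first)
      then show ?thesis using br_rep_zer[of "Suc 0" q u Q y] Q low_1[of q] by (simp add: mul_gens numeral_3_eq_3)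
    qed
    show "br R y \<in> C 3" for y
    proof -
      obtain u where "u \<in> K" "y \<in> \<psi> u 1" by (rule rep_first)
      then show ?thesis using br_rep_zer[of "Suc 0" r u R y] R low_1[of r] by (simp add: mul_gens numeral_3_eq_3)
    qed
    show "br (br (W 0) Q - W 1) y \<in> C 4" for y
    proof -
      obtain u where "u \<in> K" "y \<in> \<psi> u 1" by (rule rep_first)
      then show ?thesis using br_rep_zer[of 2 z u _ y] Z low_z by (simp add: mul_gens W0 eval_nat_numeral)
    qed
    show "br (W j) R \<in> C (j + 3)" for j
      using br_rep_zer[OF low_chain gens_K(3) _ W R] by (simp add: mul_gens eval_nat_numeral)
    show "br (W j) Q - W (Suc j) \<in> C (j + 3)" if "1 \<le> j" for j
    proof -
      have "br (W j) Q \<in> \<psi> (chain (Suc j)) (Suc (Suc j))"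
        using rep_mul(1)[OF low_chain[of j] gens_K(2) _ W Q] that by (simp add: mul_gens)
      then show ?thesis using rep_diff[OF gens_K(1) _ W] by (simp add: eval_nat_numeral)
    qed
    show "x \<in> span (insert (W 0) (insert Q (insert R (C 2))))" for x
    proof -
      obtain u where u: "u \<in> K" "x \<in> \<psi> u 1" by (rule rep_first)
      obtain w where w: "w \<in> K" and eq: "u = add (add (scl (fst u 1) (chain 0))
          (add (scl (fst u (n - 1)) q) (scl (snd u) r))) (add (mul w (chain 0)) (scl (fst u n) z))"
        using K_decompose[OF u(1)] by blast
      \<comment> \<open>The part of \<open>u\<close> beyond the generators is invisible in degree 1,
        so \<open>x\<close> is a combination of \<open>P\<close>, \<open>Q\<close>, \<open>R\<close>
        modulo \<open>C 2\<close>.\<close>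
      have "low 2 (add (mul w (chain 0)) (scl (fst u n) z))"
        using low_mul[OF low_1[OF w] gens_K(1)] low_z by (intro low_add low_scl) (simp_all add: numeral_2_eq_2)
      then have zero: "0 \<in> \<psi> (add (mul w (chain 0)) (scl (fst u n) z)) 1" by (simp add: low_def)
      have comb: "scale (fst u 1) P + (scale (fst u (n - 1)) Q + scale (snd u) R)
        \<in> \<psi> (add (scl (fst u 1) (chain 0)) (add (scl (fst u (n - 1)) q) (scl (snd u) r))) 1"
        using P Q R by (intro rep_add rep_scl) auto
      have "scale (fst u 1) P + (scale (fst u (n - 1)) Q + scale (snd u) R) + 0
        \<in> \<psi> (add (add (scl (fst u 1) (chain 0)) (add (scl (fst u (n - 1)) q) (scl (snd u) r)))
            (add (mul w (chain 0)) (scl (fst u n) z))) 1"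
        by (rule rep_add[OF _ _ comb zero]) (simp_all add: w)
      then have 1: "x - (scale (fst u 1) P + (scale (fst u (n - 1)) Q + scale (snd u) R)) \<in> C 2"
        using rep_diff[OF u] unfolding eq[symmetric] by (simp add: numeral_2_eq_2)
      let ?S = "insert (W 0) (insert Q (insert R (C 2)))"
      have "x = (x - (scale (fst u 1) P + (scale (fst u (n - 1)) Q + scale (snd u) R)))
        + (scale (fst u 1) P + (scale (fst u (n - 1)) Q + scale (snd u) R))" by simp
      also have "\<dots> \<in> span ?S"
        using 1 by (intro span_add[of _ ?S] span_scale[of _ ?S]) (auto simp: W0 intro!: span_base)
      finally show ?thesis .
    qed
  qed
qed

end

section \<open>An adapted basis\<close>

context kf5_frame
begin

abbreviation Z :: 'a where "Z \<equiv> br (W 0) Q - W 1"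

lemma W_lcs: "W j \<in> C (Suc j)"
proof (induction j)
  case (Suc j)
  then show ?case by (subst W_Suc) (rule lcs_br, auto)
qed simp

lemma W_lcs_anti: "m \<le> Suc j \<Longrightarrow> W j \<in> C m"
  using W_lcs lcs_antimono by blast

lemma W_high: "n - 2 \<le> j \<Longrightarrow> W j \<in> C (j + 2)"
proof (induction j rule: dec_induct)
  case base
  have "n - 2 + 2 = n" using n6 by simp
  then show ?case using W_last by simp
next
  case (step j)
  then show ?case by (subst W_Suc) (use lcs_br[of "W j" "j + 2"] in auto)
qed

text \<open>Induction principle for statements linear in \<open>x\<close>.\<close>

lemma generator_induct:
  assumes "subspace T" "W 0 \<in> T" "Q \<in> T" "R \<in> T" "C 2 \<subseteq> T"
  shows "x \<in> T"
  using span_minimal[OF _ assms(1), of "insert (W 0) (insert Q (insert R (C 2)))"] generators[of x] assms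
  by auto

text \<open>Modulo \<open>C (j + 3)\<close>, right multiplication by \<open>W 0\<close> and by
  \<open>Q\<close> sends \<open>W j\<close> to \<open>W (Suc j)\<close>, while \<open>R\<close> and
  \<open>C 2\<close> annihilate it.\<close>

lemma br_W:
  assumes "1 \<le> j"
  shows "br (W j) y \<in> span (insert (W (Suc j)) (C (j + 3)))" (is "_ \<in> ?T")
proof -
  have "y \<in> {y. br (W j) y \<in> ?T}"
  proof (rule generator_induct)
    show "subspace {y. br (W j) y \<in> ?T}" by (rule subspace_br_right) simp
    show "W 0 \<in> {y. br (W j) y \<in> ?T}" by (auto simp: W_Suc[symmetric] intro: span_base)
    have "W (Suc j) + (br (W j) Q - W (Suc j)) \<in> ?T"
      using W_br_Q[OF assms] by (intro span_add) (auto intro: span_base)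
    then show "Q \<in> {y. br (W j) y \<in> ?T}" by simp
    show "R \<in> {y. br (W j) y \<in> ?T}" using W_br_R by (auto intro: span_base)
    show "C 2 \<subseteq> {y. br (W j) y \<in> ?T}"
      using lcs_br_anti[OF W_lcs[of j], of _ 2 "j + 3"] by (auto intro: span_base)
  qed
  then show ?thesis by simp
qed

text \<open>Modulo \<open>C 3\<close> only \<open>W 0\<close> matters as a left factor, and its
  products with \<open>W 0\<close> and \<open>Q\<close> are \<open>W 1\<close> and
  \<open>Z + W 1\<close>.\<close>

lemma lcs_2_subset: "C 2 \<subseteq> span (insert Z (insert (W 1) (C 3)))" (is "_ \<subseteq> ?T")
proof -
  have W: "br (W 0) y \<in> ?T" for y
  proof -
    have "y \<in> {y. br (W 0) y \<in> ?T}"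
    proof (rule generator_induct)
      show "subspace {y. br (W 0) y \<in> ?T}" by (rule subspace_br_right) simp
      show "W 0 \<in> {y. br (W 0) y \<in> ?T}" by (auto simp: W_Suc[symmetric] intro: span_base)
      have "Z + W 1 \<in> ?T"
        by (intro span_add) (auto intro: span_base)
      then show "Q \<in> {y. br (W 0) y \<in> ?T}" by simp
      show "R \<in> {y. br (W 0) y \<in> ?T}" using W_br_R[of 0] by (auto intro: span_base)
      show "C 2 \<subseteq> {y. br (W 0) y \<in> ?T}"
        using lcs_br_anti[of "W 0" 1 _ 2 3] by (auto intro: span_base)
    qed
    then show ?thesis by simp
  qed
  have "br x y \<in> ?T" for x y
  proof -
    have "x \<in> {x. br x y \<in> ?T}"
    proof (rule generator_induct)
      show "subspace {x. br x y \<in> ?T}" by (rule subspace_br_left) simp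
      show "W 0 \<in> {x. br x y \<in> ?T}" using W by simp
      show "Q \<in> {x. br x y \<in> ?T}" "R \<in> {x. br x y \<in> ?T}"
        using Q_br R_br by (auto intro: span_base)
      show "C 2 \<subseteq> {x. br x y \<in> ?T}"
        using lcs_br_anti[of _ 2 y 1 3] by (auto intro: span_base)
    qed
    then show ?thesis by simp
  qed
  then have "{br x y |x y. x \<in> C (Suc 0)} \<subseteq> ?T" by blast
  then have "span {br x y |x y. x \<in> C (Suc 0)} \<subseteq> ?T" by (rule span_minimal) simp
  then show ?thesis by (simp add: numeral_2_eq_2 lcs.simps(3) del: One_nat_def)
qed

text \<open>At the first step \<open>Z_br\<close> removes \<open>Z\<close>; from then on
  \<open>br_W\<close> carries the single spanning vector \<open>W j\<close> to
  \<open>W (Suc j)\<close>.\<close>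

lemma lcs_step:
  assumes "2 \<le> j"
  shows "C (Suc j) \<subseteq> span (insert (W j) (C (j + 2)))"
  using assms
proof (induction j rule: dec_induct)
  case base
  let ?T = "span (insert (W 2) (C 4))"
  have "br x y \<in> ?T" if x: "x \<in> C 2" for x y
  proof -
    have "insert Z (insert (W 1) (C 3)) \<subseteq> {x. br x y \<in> ?T}"
      using Z_br[of y] br_W[of 1 y] lcs_br_anti[of _ 3 y 1 4]
      by (auto simp: numeral_2_eq_2 intro: span_base)
    then have "span (insert Z (insert (W 1) (C 3))) \<subseteq> {x. br x y \<in> ?T}"
      by (rule span_minimal) (rule subspace_br_left, simp)
    then show ?thesis using lcs_2_subset x by blast
  qed
  then have "{br x y |x y. x \<in> C (Suc 1)} \<subseteq> ?T" by (auto simp: numeral_2_eq_2)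
  then have "span {br x y |x y. x \<in> C (Suc 1)} \<subseteq> ?T" by (rule span_minimal) simp
  then show ?case by (simp add: numeral_2_eq_2 lcs.simps(3) eval_nat_numeral)
next
  case (step j)
  let ?T = "span (insert (W (Suc j)) (C (j + 3)))"
  have "br x y \<in> ?T" if x: "x \<in> C (Suc j)" for x y
  proof -
    have "insert (W j) (C (j + 2)) \<subseteq> {x. br x y \<in> ?T}"
      using br_W[of j y] step.hyps lcs_br_anti[of _ "j + 2" y 1 "j + 3"]
      by (auto intro: span_base)
    then have "span (insert (W j) (C (j + 2))) \<subseteq> {x. br x y \<in> ?T}"
      by (rule span_minimal) (rule subspace_br_left, simp)
    then show ?thesis using step.IH x by blast
  qed
  then have "{br x y |x y. x \<in> C (Suc j)} \<subseteq> ?T" by auto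
  then have "span {br x y |x y. x \<in> C (Suc j)} \<subseteq> ?T" by (rule span_minimal) simp
  then show ?case by (simp add: lcs.simps(3) eval_nat_numeral)
qed

text \<open>From index n - 1 on, \<open>lcs_step\<close> and \<open>W_high\<close> make the sequence
  constant, and nilpotency forces the constant to be zero.\<close>

lemma lcs_end: "C (n - 1) = {0}"
proof -
  have st: "C (Suc j) \<subseteq> C (Suc (Suc j))" if "n - 2 \<le> j" for j
  proof -
    have "span (insert (W j) (C (j + 2))) \<subseteq> C (j + 2)"
      using W_high[OF that] by (intro span_minimal) auto
    moreover have "2 \<le> j" using that n6 by linarith
    ultimately show ?thesis using lcs_step[of j] by auto
  qed
  have "C (Suc (n - 2)) \<subseteq> C (Suc j)" if "n - 2 \<le> j" for j
    using that by (induction j rule: dec_induct) (use st in auto)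
  then have *: "C (n - 1) \<subseteq> C (Suc j)" if "n - 2 \<le> j" for j
    using that n6 by (simp add: numeral_2_eq_2 Suc_diff_Suc)
  obtain m where "C m = {0}" using nilp by (auto simp: nilpotent_alg_def)
  then have "C (Suc (m + n)) \<subseteq> {0}" using lcs_antimono[of m "Suc (m + n)"] by auto
  moreover have "n - 2 \<le> m + n" by linarith
  ultimately show ?thesis using *[of "m + n"] by auto
qed

text \<open>Downward induction from \<open>lcs_end\<close>, each step contributing one
  \<open>W j\<close>.\<close>

lemma lcs_span:
  assumes "2 \<le> j" "j \<le> n - 2"
  shows "C (Suc j) \<subseteq> span (W ` {j..<n - 2})"
  using assms(2,1)
proof (induction j rule: inc_induct)
  case base
  have "Suc (n - 2) = n - 1" using n6 by simp
  then show ?case using lcs_end by simp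
next
  case (step j)
  have "insert (W j) (C (j + 2)) \<subseteq> span (W ` {j..<n - 2})"
    using step span_mono[OF image_mono, of "{Suc j..<n - 2}" "{j..<n - 2}" W]
    by (auto intro: span_base)
  then have "span (insert (W j) (C (j + 2))) \<subseteq> span (W ` {j..<n - 2})"
    by (rule span_minimal) simp
  then show ?case using lcs_step[of j] step by auto
qed

lemma lcs_2_span: "C 2 \<subseteq> span (insert Z (W ` {1..<n - 2}))"
proof -
  have "C 3 \<subseteq> span (W ` {2..<n - 2})" using lcs_span[of 2] n6 by (simp add: eval_nat_numeral)
  also have "\<dots> \<subseteq> span (insert Z (W ` {1..<n - 2}))" by (rule span_mono) auto
  finally have "insert Z (insert (W 1) (C 3)) \<subseteq> span (insert Z (W ` {1..<n - 2}))"
    using n6 by (auto intro: span_base)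
  then have "span (insert Z (insert (W 1) (C 3))) \<subseteq> span (insert Z (W ` {1..<n - 2}))"
    by (rule span_minimal) simp
  then show ?thesis using lcs_2_subset by blast
qed

text \<open>Three vectors and n - 2 vectors \<open>W j\<close>, so at most n + 1 elements;
  coincidences are excluded later by the dimension.\<close>

definition B :: "'a set" where
  "B = insert Q (insert R (insert Z (W ` {0..<n - 2})))"

lemma B_span: "x \<in> span B"
proof (rule generator_induct)
  show "C 2 \<subseteq> span B"
    by (rule order_trans[OF lcs_2_span span_mono]) (auto simp: B_def)
qed (use n6 in \<open>auto simp: B_def intro!: span_base\<close>)

end

locale kf5_basis = kf5_frame +
  assumes dim_UNIV: "dim (UNIV :: 'a set) = n + 1"
begin

lemma finite_B [simp]: "finite B"
  by (simp add: B_def)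

lemma card_W: "card (W ` {0..<n - 2}) \<le> n - 2"
  using card_image_le[of "{0..<n - 2}" W] by simp

text \<open>A spanning set with at most n + 1 elements in dimension n + 1 equals any basis contained
  in it.\<close>

lemma B_basis: "independent B" "card B = n + 1"
proof -
  have le: "card B \<le> n + 1"
  proof -
    have "card B \<le> Suc (Suc (Suc (card (W ` {0..<n - 2}))))"
      unfolding B_def by (intro card_insert_le_m1 order_refl le_SucI) auto
    then show ?thesis using card_W n6 by linarith
  qed
  obtain D where D: "D \<subseteq> B" "independent D" "B \<subseteq> span D"
    by (rule maximal_independent_subset)
  have "span D = UNIV" using span_minimal[OF D(3)] B_span by auto
  then have "card D = n + 1" using dim_eq_card[of D UNIV] D(2) dim_UNIV by simp
  then have "D = B" using D(1) le card_seteq[of B D] by simp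
  then show "independent B" "card B = n + 1" using D(2) \<open>card D = n + 1\<close> by simp_all
qed

text \<open>\<open>B\<close> has the largest cardinality its definition allows, so none of the
  insertions repeats an element.\<close>

lemma distinct_B:
  "inj_on W {0..<n - 2}" "Z \<notin> W ` {0..<n - 2}" "Q \<noteq> Z" "Q \<notin> W ` {0..<n - 2}"
  "Q \<noteq> R" "R \<notin> W ` {0..<n - 2}"
proof -
  let ?w = "W ` {0..<n - 2}"
  have c: "card (insert Q (insert R (insert Z ?w))) = n + 1" using B_basis by (simp add: B_def)
  have "card (insert R (insert Z ?w)) \<le> Suc (card (insert Z ?w))" "card (insert Z ?w) \<le> Suc (card ?w)"
    "card (insert Q (insert R (insert Z ?w))) \<le> Suc (card (insert R (insert Z ?w)))"
    by (simp_all add: card_insert_if)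
  then have *: "card ?w = n - 2" "card (insert Z ?w) = n - 1" "card (insert R (insert Z ?w)) = n"
    using c card_W n6 by linarith+
  show "inj_on W {0..<n - 2}" using *(1) by (intro eq_card_imp_inj_on) auto
  show "Z \<notin> ?w" using *(1,2) n6 by (auto simp: card_insert_if)
  have "Q \<notin> insert R (insert Z ?w)" using *(3) c n6 by (auto simp: card_insert_if simp del: insert_iff split: if_splits)
  then show "Q \<noteq> Z" "Q \<notin> ?w" "Q \<noteq> R" by auto
  have "R \<notin> insert Z ?w" using *(2,3) n6 by (auto simp: card_insert_if simp del: insert_iff split: if_splits)
  then show "R \<notin> ?w" by auto
qed

section \<open>Coordinates, and leading terms of products\<close>

lemma W_eq: "i < n - 2 \<Longrightarrow> j < n - 2 \<Longrightarrow> W i = W j \<longleftrightarrow> i = j"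
  using inj_on_eq_iff[OF distinct_B(1)] by simp

definition crd :: "'a \<Rightarrow> 'a \<Rightarrow> complex" where
  "crd b x = representation B x b"

lemma crd_add: "crd b (x + y) = crd b x + crd b y"
  by (simp add: crd_def representation_add[OF B_basis(1) B_span B_span])

lemma crd_scale: "crd b (scale c x) = c * crd b x"
  by (simp add: crd_def representation_scale[OF B_basis(1) B_span])

lemma crd_diff: "crd b (x - y) = crd b x - crd b y"
  using crd_add[of b "x - y" y] by simp

lemma crd_zero [simp]: "crd b 0 = 0"
  using crd_scale[of b 0 0] by simp

lemma crd_B: "a \<in> B \<Longrightarrow> crd b a = (if b = a then 1 else 0)"
  by (simp add: crd_def representation_basis[OF B_basis(1)])

lemma crd_span:
  assumes "S \<subseteq> B" "b \<notin> S" "x \<in> span S"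
  shows "crd b x = 0"
proof -
  have "span S \<subseteq> {x. crd b x = 0}"
    by (rule span_minimal) (use assms in \<open>auto simp: subspace_def crd_add crd_scale crd_B\<close>)
  then show ?thesis using assms(3) by auto
qed

abbreviation "\<alpha> \<equiv> crd (W 0)"
abbreviation "\<beta> \<equiv> crd Q"

lemma lcs_crd_2: "x \<in> C 2 \<Longrightarrow> \<alpha> x = 0" "x \<in> C 2 \<Longrightarrow> \<beta> x = 0"
proof -
  assume x: "x \<in> C 2"
  have W: "W i = W 0 \<longleftrightarrow> i = 0" if "i < n - 2" for i using W_eq[of i 0] that n6 by auto
  have n: "0 < n - 2" using n6 by simp
  show "\<alpha> x = 0"
    by (rule crd_span[OF _ _ subsetD[OF lcs_2_span x]]) (use W distinct_B(2) n in \<open>force simp: B_def\<close>)+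
  show "\<beta> x = 0"
    by (rule crd_span[OF _ _ subsetD[OF lcs_2_span x]]) (use distinct_B(3,4) in \<open>force simp: B_def\<close>)+
qed

text \<open>\<open>C (j + 2)\<close> is spanned by the later \<open>W i\<close>, so a nonzero
  coordinate along \<open>W j\<close> shows that an element lies outside it.\<close>

lemma lcs_crd_W:
  assumes "1 \<le> j" "j < n - 2" "x \<in> C (j + 2)"
  shows "crd (W j) x = 0"
proof (rule crd_span[OF _ _ subsetD[OF lcs_span[of "Suc j"]]])
  show "W j \<notin> W ` {Suc j..<n - 2}"
    using inj_on_image_mem_iff[OF distinct_B(1), of j "{Suc j..<n - 2}"] assms(2) by auto
qed (use assms in \<open>auto simp: B_def\<close>)

lemma lcs_crd_Z: "x \<in> C 3 \<Longrightarrow> crd Z x = 0"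
  by (rule crd_span[OF _ _ subsetD[OF lcs_span[of 2]]])
     (use n6 distinct_B(2) in \<open>auto simp: B_def eval_nat_numeral\<close>)

lemma crd_gens:
  "\<alpha> (W 0) = 1" "\<beta> (W 0) = 0" "\<alpha> Q = 0" "\<beta> Q = 1" 
  "crd (W 1) (W 1) = 1" "crd (W 1) Z = 0" "crd Z Z = 1" "crd Z (W 1) = 0"
  "j < n - 2 \<Longrightarrow> crd (W j) (W j) = 1"
  using n6 distinct_B by (auto simp: crd_B B_def)

lemma alpha_beta_R: "\<alpha> R = 0 \<and> \<beta> R = 0"
  using n6 distinct_B by (auto simp: crd_B B_def)

text \<open>e_1 and e_(n-1) act alike on the chain beyond e_1, so only the sum of the two
  coordinates of \<open>y\<close> enters.\<close>

lemma prod_W: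
  assumes "1 \<le> j"
  shows "br (W j) y - scale (\<alpha> y + \<beta> y) (W (Suc j)) \<in> C (j + 3)"
proof -
  have "y \<in> {y. br (W j) y - scale (\<alpha> y + \<beta> y) (W (Suc j)) \<in> C (j + 3)}" (is "_ \<in> ?T")
  proof (rule generator_induct)
    have "br (W j) (x + y) - scale (\<alpha> (x + y) + \<beta> (x + y)) (W (Suc j))
      = (br (W j) x - scale (\<alpha> x + \<beta> x) (W (Suc j))) + (br (W j) y - scale (\<alpha> y + \<beta> y) (W (Suc j)))"
      for x y by (simp add: br_add_right crd_add scale_left_distrib algebra_simps)
    moreover have "br (W j) (scale c x) - scale (\<alpha> (scale c x) + \<beta> (scale c x)) (W (Suc j))
      = scale c (br (W j) x - scale (\<alpha> x + \<beta> x) (W (Suc j)))" for c x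
      by (simp add: br_scale_right crd_scale scale_right_diff_distrib distrib_left)
    ultimately show "subspace ?T"
      unfolding subspace_def mem_Collect_eq
      using subspace_add[OF subspace_lcs] subspace_scale[OF subspace_lcs] by auto
    show "W 0 \<in> ?T" by (simp add: crd_gens W_Suc[symmetric])
    show "Q \<in> ?T" using W_br_Q[OF assms] by (simp add: crd_gens)
    show "R \<in> ?T" using W_br_R by (simp add: alpha_beta_R)
    show "C 2 \<subseteq> ?T" using lcs_br_anti[OF W_lcs[of j], of _ 2 "j + 3"] lcs_crd_2 by auto
  qed
  then show ?thesis by simp
qed

text \<open>Linearity in \<open>y\<close> settles the left factor \<open>W 0\<close>; linearity in
  \<open>x\<close> then gives the rest, since \<open>Q\<close>, \<open>R\<close> and
  \<open>C 2\<close> on the left multiply into \<open>C 3\<close>.\<close>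

lemma prod_gen:
  "br x y - scale (\<alpha> x) (scale (\<alpha> y + \<beta> y) (W 1) + scale (\<beta> y) Z) \<in> C 3"
proof -
  have W: "br (W 0) y - (scale (\<alpha> y + \<beta> y) (W 1) + scale (\<beta> y) Z) \<in> C 3"
  proof -
    have "y \<in> {y. br (W 0) y - (scale (\<alpha> y + \<beta> y) (W 1) + scale (\<beta> y) Z) \<in> C 3}" (is "_ \<in> ?T")
    proof (rule generator_induct)
      have "br (W 0) (x + y) - (scale (\<alpha> (x + y) + \<beta> (x + y)) (W 1) + scale (\<beta> (x + y)) Z)
        = (br (W 0) x - (scale (\<alpha> x + \<beta> x) (W 1) + scale (\<beta> x) Z))
          + (br (W 0) y - (scale (\<alpha> y + \<beta> y) (W 1) + scale (\<beta> y) Z))"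
        for x y by (simp add: br_add_right crd_add scale_left_distrib del: One_nat_def)
      moreover have "br (W 0) (scale c x) - (scale (\<alpha> (scale c x) + \<beta> (scale c x)) (W 1) + scale (\<beta> (scale c x)) Z)
        = scale c (br (W 0) x - (scale (\<alpha> x + \<beta> x) (W 1) + scale (\<beta> x) Z))" for c x
        by (simp add: br_scale_right crd_scale scale_right_diff_distrib scale_right_distrib distrib_left)
      ultimately show "subspace ?T"
        unfolding subspace_def mem_Collect_eq
        using subspace_add[OF subspace_lcs] subspace_scale[OF subspace_lcs] by auto
      show "W 0 \<in> ?T" by (simp add: crd_gens W_Suc[symmetric])
      show "Q \<in> ?T" by (simp add: crd_gens)
      show "R \<in> ?T" using W_br_R[of 0] by (simp add: alpha_beta_R)
      show "C 2 \<subseteq> ?T" using lcs_br_anti[of "W 0" 1 _ 2 3] lcs_crd_2 by auto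
    qed
    then show ?thesis by simp
  qed
  have "x \<in> {x. br x y - scale (\<alpha> x) (scale (\<alpha> y + \<beta> y) (W 1) + scale (\<beta> y) Z) \<in> C 3}" (is "_ \<in> ?T")
  proof (rule generator_induct)
    let ?u = "scale (\<alpha> y + \<beta> y) (W 1) + scale (\<beta> y) Z"
    have "br (x + x') y - scale (\<alpha> (x + x')) ?u = (br x y - scale (\<alpha> x) ?u) + (br x' y - scale (\<alpha> x') ?u)"
      for x x' by (simp add: br_add_left crd_add scale_left_distrib del: One_nat_def)
    moreover have "br (scale c x) y - scale (\<alpha> (scale c x)) ?u = scale c (br x y - scale (\<alpha> x) ?u)" for c x
      by (simp add: br_scale_left crd_scale scale_right_diff_distrib)
    ultimately show "subspace ?T"
      unfolding subspace_def mem_Collect_eq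
      using subspace_add[OF subspace_lcs] subspace_scale[OF subspace_lcs] by auto
    show "W 0 \<in> ?T" using W by (simp add: crd_gens)
    show "Q \<in> ?T" using Q_br by (simp add: crd_gens)
    show "R \<in> ?T" using R_br by (simp add: alpha_beta_R)
    show "C 2 \<subseteq> ?T" using lcs_br_anti[of _ 2 y 1 3] lcs_crd_2 by auto
  qed
  then show ?thesis by simp
qed

end

section \<open>Gradations\<close>

locale graded_leibniz = leibniz_algebra +
  fixes V :: "int \<Rightarrow> 'a set" and k :: int and t :: nat
  assumes conn: "connected_gradation scale br V k t"
begin

abbreviation I :: "int set" where "I \<equiv> {k..k + int t}"

lemma V_subspace: "subspace (V i)"
  and V_nonzero: "i \<in> I \<Longrightarrow> V i \<noteq> {0}"
  and V_outside: "i \<notin> I \<Longrightarrow> V i = {0}"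
  and V_decompose: "\<exists>!f. (\<forall>i. f i \<in> V i) \<and> x = sum f I"
  and V_br: "x \<in> V i \<Longrightarrow> y \<in> V j \<Longrightarrow> br x y \<in> V (i + j)"
  using conn unfolding connected_gradation_def by blast+

lemma V_degree: "x \<in> V d \<Longrightarrow> x \<noteq> 0 \<Longrightarrow> d \<in> I"
  using V_outside by blast

definition proj :: "'a \<Rightarrow> int \<Rightarrow> 'a" where
  "proj x = (THE f. (\<forall>i. f i \<in> V i) \<and> x = sum f I)"

lemma proj_in: "proj x i \<in> V i" and proj_sum: "x = sum (proj x) I"
  using theI'[OF V_decompose, of x] unfolding proj_def by blast+

lemma proj_eq: "(\<And>i. f i \<in> V i) \<Longrightarrow> x = sum f I \<Longrightarrow> proj x = f"
  using V_decompose[of x] proj_in proj_sum by blast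

lemma proj_add: "proj (x + y) i = proj x i + proj y i"
proof -
  have "proj (x + y) = (\<lambda>i. proj x i + proj y i)"
    using proj_in proj_sum by (intro proj_eq) (auto simp: sum.distrib intro: subspace_add[OF V_subspace])
  then show ?thesis by simp
qed

lemma proj_scale: "proj (scale c x) i = scale c (proj x i)"
proof -
  have "proj (scale c x) = (\<lambda>i. scale c (proj x i))"
    using proj_in proj_sum[of x]
    by (intro proj_eq) (auto simp: scale_sum_right[symmetric] intro: subspace_scale[OF V_subspace])
  then show ?thesis by simp
qed

lemma proj_hom:
  assumes "x \<in> V d"
  shows "proj x i = (if i = d then x else 0)"
proof -
  have "proj x = (\<lambda>i. if i = d then x else 0)"
    using assms V_outside[of d] subspace_0[OF V_subspace]
    by (intro proj_eq) (auto simp: sum.delta)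
  then show ?thesis by simp
qed

lemma subspace_proj: "subspace T \<Longrightarrow> subspace {x. proj x i \<in> T}"
  using proj_hom[OF subspace_0[OF V_subspace]]
  by (auto simp: subspace_def proj_add proj_scale)

text \<open>The products of homogeneous components are homogeneous, so projecting one of them gives
  the product itself or zero.\<close>

lemma lcs_proj: "x \<in> C m \<Longrightarrow> proj x d \<in> C m"
proof (induction m arbitrary: x d rule: induct_nat_012)
  case (ge2 m)
  have "br x y \<in> {z. proj z d \<in> C (Suc (Suc m))}" if x: "x \<in> C (Suc m)" for x y
  proof -
    have "proj (br (proj x i) (proj y j)) d \<in> C (Suc (Suc m))" for i j
      using lcs_br[OF ge2.IH(2)[OF x, of i], of "proj y j"] proj_hom[OF V_br[OF proj_in proj_in], of x i y j d]
      by simp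
    then have "(\<Sum>i\<in>I. \<Sum>j\<in>I. br (proj x i) (proj y j)) \<in> {z. proj z d \<in> C (Suc (Suc m))}"
      by (intro subspace_sum subspace_proj) auto
    moreover have "br (sum (proj x) I) (sum (proj y) I) = (\<Sum>i\<in>I. \<Sum>j\<in>I. br (proj x i) (proj y j))"
      by (simp only: br_sum_left) (simp only: br_sum_right)
    then have "br x y = (\<Sum>i\<in>I. \<Sum>j\<in>I. br (proj x i) (proj y j))"
      unfolding proj_sum[symmetric] .
    ultimately show ?thesis by simp
  qed
  then have "{br x y |x y. x \<in> C (Suc m)} \<subseteq> {z. proj z d \<in> C (Suc (Suc m))}" by blast
  then have "span {br x y |x y. x \<in> C (Suc m)} \<subseteq> {z. proj z d \<in> C (Suc (Suc m))}"
    by (rule span_minimal) (rule subspace_proj, simp)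
  then show ?case using ge2.prems by (auto simp: lcs.simps(3))
qed auto

text \<open>\<open>x\<close> is the component of degree \<open>i\<close> of \<open>x - y\<close>,
  and \<open>C m\<close> contains the components of its elements.\<close>

lemma lcs_hom_diff:
  assumes "x \<in> V i" "y \<in> V j" "i \<noteq> j" "x - y \<in> C m"
  shows "x \<in> C m"
proof -
  have "proj (x - y) i = x"
    using assms proj_add[of "x - y" y i] by (simp add: proj_hom)
  then show ?thesis using lcs_proj[OF assms(4)] by metis
qed

section \<open>Nonzero homogeneous vectors and the dimension bound\<close>

definition hom :: "int \<Rightarrow> 'a" where
  "hom i = (SOME x. x \<in> V i \<and> x \<noteq> 0)"

lemma hom_V: "i \<in> I \<Longrightarrow> hom i \<in> V i" and hom_nonzero: "i \<in> I \<Longrightarrow> hom i \<noteq> 0"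
proof -
  assume "i \<in> I"
  then have "\<exists>x. x \<in> V i \<and> x \<noteq> 0" using V_nonzero[of i] subspace_0[OF V_subspace, of i] by blast
  then show "hom i \<in> V i" "hom i \<noteq> 0" unfolding hom_def by (metis (mono_tags, lifting) someI_ex)+
qed

lemma hom_inj: "inj_on hom I"
proof (rule inj_onI)
  fix i j assume "i \<in> I" "j \<in> I" "hom i = hom j"
  then show "i = j"
    using proj_hom[OF hom_V[of i], of i] proj_hom[OF hom_V[of j], of i] hom_nonzero[of i]
    by (auto split: if_splits)
qed

text \<open>A vanishing combination is a decomposition of zero into homogeneous components, which is
  unique.\<close>

lemma hom_independent: "independent (hom ` I)"
proof (rule independent_if_scalars_zero)
  fix f x assume sum: "(\<Sum>x\<in>hom ` I. scale (f x) x) = 0" and "x \<in> hom ` I"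
  then obtain d where d: "d \<in> I" "x = hom d" by blast
  have "(\<lambda>i. if i \<in> I then scale (f (hom i)) (hom i) else 0) = (\<lambda>i. 0)"
  proof -
    have "proj 0 = (\<lambda>i. if i \<in> I then scale (f (hom i)) (hom i) else 0)"
      using sum hom_V subspace_0[OF V_subspace] subspace_scale[OF V_subspace]
      by (intro proj_eq) (auto simp: sum.reindex[OF hom_inj])
    moreover have "proj 0 = (\<lambda>i. 0)"
      using subspace_0[OF V_subspace] by (intro proj_eq) auto
    ultimately show ?thesis by simp
  qed
  then have "scale (f (hom d)) (hom d) = 0" using d(1) by (auto dest: fun_cong[of _ _ d])
  then show "f x = 0" using hom_nonzero[OF d(1)] d(2) by simp
qed simp

lemma ex_basis:
  obtains B where "finite B" "independent B" "span B = UNIV" "card B = dim (UNIV :: 'a set)"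
proof -
  obtain A where A: "finite A" "span A = UNIV" using finite_dim by blast
  obtain D where D: "D \<subseteq> A" "independent D" "A \<subseteq> span D" by (rule maximal_independent_subset)
  have "span D = UNIV" using span_minimal[OF D(3)] A by auto
  moreover have "finite D" using D(1) A(1) by (rule finite_subset)
  ultimately show ?thesis using that[of D] D dim_eq_card[of D UNIV] by auto
qed

lemma length_le_dim: "t + 1 \<le> dim (UNIV :: 'a set)"
proof -
  obtain B where B: "finite B" "independent B" "span B = UNIV" "card B = dim (UNIV :: 'a set)"
    by (rule ex_basis)
  have "card (hom ` I) \<le> card B"
    using independent_span_bound[OF B(1) hom_independent] B(3) by auto
  then show ?thesis using B(4) by (simp add: card_image[OF hom_inj])
qed

end

text \<open>With as many degrees as dimensions, every component is a line and the vectors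
  \<open>hom i\<close> form a basis.\<close>

locale fine_graded_leibniz = graded_leibniz +
  assumes fine: "t + 1 = dim (UNIV :: 'a set)"
begin

lemma hom_span: "span (hom ` I) = UNIV"
proof -
  obtain B where B: "finite B" "independent B" "span B = UNIV" "card B = dim (UNIV :: 'a set)"
    by (rule ex_basis)
  have card: "card (hom ` I) = dim (UNIV :: 'a set)" using fine by (simp add: card_image[OF hom_inj])
  have "x \<in> span (hom ` I)" for x
  proof (rule ccontr)
    assume x: "x \<notin> span (hom ` I)"
    then have "independent (insert x (hom ` I))" using hom_independent by (simp add: independent_insert)
    then have "card (insert x (hom ` I)) \<le> card B"
      using independent_span_bound[OF B(1)] B(3) by auto
    moreover have "x \<notin> hom ` I" using x span_base by blast
    ultimately show False using card B(4) by simp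
  qed
  then show ?thesis by auto
qed

lemma hom_induct: "subspace T \<Longrightarrow> (\<And>i. i \<in> I \<Longrightarrow> hom i \<in> T) \<Longrightarrow> x \<in> T"
  using span_minimal[of "hom ` I" T] unfolding hom_span by blast

text \<open>The projection to degree \<open>d\<close> kills every basis vector except
  \<open>hom d\<close>.\<close>

lemma V_multiple:
  assumes "x \<in> V d" "y \<in> V d" "y \<noteq> 0"
  shows "\<exists>c. x = scale c y"
proof -
  have d: "d \<in> I" using assms V_degree by blast
  have hom: "\<exists>c. z = scale c (hom d)" if z: "z \<in> V d" for z
  proof -
    have "z \<in> {z. proj z d \<in> span {hom d}}"
    proof (rule hom_induct)
      show "subspace {z. proj z d \<in> span {hom d}}" by (rule subspace_proj) simp
      show "hom i \<in> {z. proj z d \<in> span {hom d}}" if "i \<in> I" for i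
        using proj_hom[OF hom_V[OF that], of d] by (auto intro: span_base span_zero)
    qed
    then show ?thesis using proj_hom[OF z, of d] by (auto simp: span_singleton)
  qed
  obtain a b where "x = scale a (hom d)" "y = scale b (hom d)" using hom assms by metis
  then show ?thesis using assms(3) by (intro exI[of _ "a / b"]) auto
qed

text \<open>Vectors of equal degree are multiples of any nonzero one among them, so membership in
  \<open>C m\<close> would pass from \<open>y\<close> to \<open>x\<close>.\<close>

lemma degree_distinct:
  assumes "x \<in> V d" "x \<notin> C m" "y \<in> V d'" "y \<in> C m" "y \<noteq> 0"
  shows "d \<noteq> d'"
  using V_multiple[of x d y] assms subspace_scale[OF subspace_lcs] by metis

end

section \<open>The degrees of a fine gradation\<close>

text \<open>The progression covers a distance of (n - 3) b, which must be at most n; this leaves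
  only b = 1 and, for n = 6, b = 2.\<close>

lemma degree_arith_pos:
  fixes a b k :: int and n :: nat
  assumes "n \<ge> 6" "b > 0"
    and prog: "\<And>i. i \<le> n - 3 \<Longrightarrow> k \<le> a + int i * b \<and> a + int i * b \<le> k + int n"
    and b: "k \<le> b" "b \<le> k + int n" and aa: "k \<le> 2 * a" "2 * a \<le> k + int n"
    and "\<And>i. i \<le> n - 3 \<Longrightarrow> a + int i * b \<noteq> b"
    and "\<And>i. i \<le> n - 3 \<Longrightarrow> a + int i * b \<noteq> 2 * a"
    and "2 * a \<noteq> b"
  shows False
proof -
  define m where "m = n - 3"
  have n: "int n = int m + 3" "m \<ge> 3" using assms(1) by (auto simp: m_def)
  have prog: "k \<le> a + int i * b \<and> a + int i * b \<le> k + int m + 3"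
    and ne: "a + int i * b \<noteq> b" "a + int i * b \<noteq> 2 * a" if "i \<le> m" for i
    using assms(3)[of i] assms(8,9)[of i] that n(1) unfolding m_def[symmetric] by linarith+
  have le: "k \<le> a" "a + int m * b \<le> k + int m + 3"
    using prog[of 0] prog[of m] by simp_all
  then have mb: "int m * b \<le> int m + 3" by linarith
  consider "b = 1" | "b = 2" | "b \<ge> 3" using assms(2) by linarith
  then show False
  proof cases
    case 1
    \<comment> \<open>For step 1 the progression fills an interval of integers; \<open>b\<close> and
      \<open>2 * a\<close> must lie outside it, which pushes them out of the allowed range.\<close>
    have not: "\<not> (a \<le> d \<and> d \<le> a + int m)" if "d = 1 \<or> d = 2 * a" for d
    proof
      assume d: "a \<le> d \<and> d \<le> a + int m"
      then have "nat (d - a) \<le> m" "a + int (nat (d - a)) * b = d" using 1 by (simp_all add: nat_le_iff)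
      then show False using ne[of "nat (d - a)"] that 1 by simp
    qed
    have "1 < a \<or> a + int m < 1" "2 * a < a \<or> a + int m < 2 * a"
      using not[of 1] not[of "2 * a"] by linarith+
    then show False using le b aa n 1 by linarith
  next
    case 2
    \<comment> \<open>Now the progression fills the whole range, so a = k and a is 0, 1 or 2. These
      values mean a + b = b, 2 a = b and a = b.\<close>
    then have m: "m = 3" using mb n by simp
    have "a \<noteq> 2" "a \<noteq> 0" "a \<noteq> 1"
      using ne(1)[of 0] ne(1)[of 1] assms(10) 2 m by simp_all
    moreover have "a \<le> 2" "0 \<le> a" using le b aa n m 2 by simp_all
    ultimately show False by linarith
  next
    case 3
    have "int m * 3 \<le> int m * b" using 3 by (intro mult_left_mono) auto
    then show False using mb n by linarith
  qed
qed

text \<open>A negative \<open>b\<close> is handled by changing the sign of all degrees, which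
  reflects the interval.\<close>

lemma degree_arith:
  fixes a b k :: int and n :: nat
  assumes "n \<ge> 6" "b \<noteq> 0"
    and "\<And>i. i \<le> n - 3 \<Longrightarrow> k \<le> a + int i * b \<and> a + int i * b \<le> k + int n"
    and "k \<le> b" "b \<le> k + int n" and "k \<le> 2 * a" "2 * a \<le> k + int n"
    and "\<And>i. i \<le> n - 3 \<Longrightarrow> a + int i * b \<noteq> b"
    and "\<And>i. i \<le> n - 3 \<Longrightarrow> a + int i * b \<noteq> 2 * a"
    and "2 * a \<noteq> b"
  shows False
proof (cases "b > 0")
  case True
  show False by (rule degree_arith_pos[of n b k a]) (use assms True in auto)
next
  case False
  show False
  proof (rule degree_arith_pos[of n "- b" "- k - int n" "- a"])
    show "- k - int n \<le> - a + int i * - b \<and> - a + int i * - b \<le> - k - int n + int n" if "i \<le> n - 3" for i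
      using assms(3)[OF that] by auto
    show "- a + int i * - b \<noteq> - b" if "i \<le> n - 3" for i using assms(8)[OF that] by auto
    show "- a + int i * - b \<noteq> 2 * - a" if "i \<le> n - 3" for i using assms(9)[OF that] by auto
  qed (use assms False in auto)
qed

locale kf5_fine = kf5_basis + fine_graded_leibniz
begin

lemma t_eq: "t = n"
  using fine dim_UNIV by simp

lemma alpha_ex: "\<exists>a\<in>I. \<alpha> (hom a) \<noteq> 0"
proof (rule ccontr)
  assume *: "\<not> ?thesis"
  have "W 0 \<in> {x. \<alpha> x = 0}"
    by (rule hom_induct) (use * in \<open>auto simp: subspace_def crd_add crd_scale\<close>)
  then show False by (simp add: crd_gens)
qed

text \<open>The coordinates of the leading term along \<open>W 1\<close> and \<open>Z\<close> are
  nonzero multiples of \<open>\<alpha> y + \<beta> y\<close> and \<open>\<beta> y\<close>, which do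
  not both vanish.\<close>

lemma prod_notin:
  assumes "\<alpha> x \<noteq> 0" "\<alpha> y \<noteq> 0 \<or> \<beta> y \<noteq> 0"
  shows "br x y \<notin> C 3"
proof
  assume x: "br x y \<in> C 3"
  let ?u = "scale (\<alpha> x) (scale (\<alpha> y + \<beta> y) (W 1) + scale (\<beta> y) Z)"
  have "br x y - (br x y - ?u) \<in> C 3"
    by (rule subspace_diff[OF subspace_lcs x prod_gen])
  then have u: "?u \<in> C 3" by (simp del: One_nat_def)
  have "crd (W 1) ?u = 0" using lcs_crd_W[of 1 ?u] u n6 by (simp add: eval_nat_numeral)
  moreover have "crd Z ?u = 0" using lcs_crd_Z[OF u] .
  ultimately show False using assms by (simp add: crd_add crd_scale crd_gens del: One_nat_def)
qed

text \<open>For a fixed right factor, left factors enter modulo \<open>C 3\<close> only through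
  \<alpha>, so \<open>br ?x ?x\<close> and \<open>br ?y ?x\<close> are proportional there. If their
  degrees differed, \<open>lcs_hom_diff\<close> would put \<open>br ?x ?x\<close> into
  \<open>C 3\<close>, against \<open>prod_notin\<close>.\<close>

lemma alpha_unique:
  assumes "a \<in> I" "i \<in> I" "\<alpha> (hom a) \<noteq> 0" "\<alpha> (hom i) \<noteq> 0"
  shows "i = a"
proof (rule ccontr)
  assume ne: "i \<noteq> a"
  let ?x = "hom a" and ?y = "hom i"
  let ?u = "scale (\<alpha> ?x + \<beta> ?x) (W 1) + scale (\<beta> ?x) Z"
  have diff_cancel: "p - s - (q - s) = p - q" for p q s :: 'a by simp
  have 1: "scale (\<alpha> ?y) (br ?x ?x) - scale (\<alpha> ?y) (scale (\<alpha> ?x) ?u) \<in> C 3"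
    using subspace_scale[OF subspace_lcs prod_gen[of ?x ?x], of "\<alpha> ?y"]
    by (simp only: scale_right_diff_distrib)
  have 2: "scale (\<alpha> ?x) (br ?y ?x) - scale (\<alpha> ?x) (scale (\<alpha> ?y) ?u) \<in> C 3"
    using subspace_scale[OF subspace_lcs prod_gen[of ?y ?x], of "\<alpha> ?x"]
    by (simp only: scale_right_diff_distrib)
  have "scale (\<alpha> ?x) (scale (\<alpha> ?y) ?u) = scale (\<alpha> ?y) (scale (\<alpha> ?x) ?u)"
    by (simp only: scale_scale mult.commute)
  then have diff: "scale (\<alpha> ?y) (br ?x ?x) - scale (\<alpha> ?x) (br ?y ?x) \<in> C 3"
    using subspace_diff[OF subspace_lcs 1 2] by (simp only: diff_cancel)
  have "scale (\<alpha> ?y) (br ?x ?x) \<in> C 3"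
  proof (rule lcs_hom_diff[OF _ _ _ diff])
    show "scale (\<alpha> ?y) (br ?x ?x) \<in> V (a + a)" "scale (\<alpha> ?x) (br ?y ?x) \<in> V (i + a)"
      by (intro subspace_scale[OF V_subspace] V_br hom_V assms)+
  qed (use ne in auto)
  then have "scale (1 / \<alpha> ?y) (scale (\<alpha> ?y) (br ?x ?x)) \<in> C 3"
    by (rule subspace_scale[OF subspace_lcs])
  then show False using prod_notin[of ?x ?x] assms by simp
qed

text \<open>Otherwise the linear form
  \<open>\<beta> x * \<alpha> (hom a) - \<alpha> x * \<beta> (hom a)\<close> would vanish on the
  homogeneous basis, but at \<open>Q\<close> it equals \<open>\<alpha> (hom a)\<close>.\<close>

lemma beta_ex:
  assumes "a \<in> I" "\<alpha> (hom a) \<noteq> 0"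
  shows "\<exists>b\<in>I. \<alpha> (hom b) = 0 \<and> \<beta> (hom b) \<noteq> 0"
proof (rule ccontr)
  assume *: "\<not> ?thesis"
  have "Q \<in> {x. \<beta> x * \<alpha> (hom a) - \<alpha> x * \<beta> (hom a) = 0}"
  proof (rule hom_induct)
    show "subspace {x. \<beta> x * \<alpha> (hom a) - \<alpha> x * \<beta> (hom a) = 0}"
      by (auto simp: subspace_def crd_add crd_scale algebra_simps)
    show "hom i \<in> {x. \<beta> x * \<alpha> (hom a) - \<alpha> x * \<beta> (hom a) = 0}" if "i \<in> I" for i
      using * that alpha_unique[OF assms(1) that assms(2)] by (cases "\<alpha> (hom i) = 0") auto
  qed
  then show False using assms by (simp add: crd_gens)
qed

lemma no_fine_gradation: False
proof -
  obtain a where a: "a \<in> I" "\<alpha> (hom a) \<noteq> 0" using alpha_ex by blast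
  obtain b where b: "b \<in> I" "\<alpha> (hom b) = 0" "\<beta> (hom b) \<noteq> 0" using beta_ex[OF a] by blast
  define x where "x = hom a"
  define y where "y = hom b"
  define u where "u j = ((\<lambda>z. br z y) ^^ j) x" for j
  have u0: "u 0 = x" and uS: "u (Suc j) = br (u j) y" for j by (simp_all add: u_def)
  have x: "x \<in> V a" "\<alpha> x \<noteq> 0" and y: "y \<in> V b" "\<alpha> y = 0" "\<beta> y \<noteq> 0"
    using a b hom_V by (auto simp: x_def y_def)
  have uV: "u j \<in> V (a + int j * b)" for j
  proof (induction j)
    case (Suc j)
    have "a + int j * b + b = a + int (Suc j) * b" by (simp add: algebra_simps)
    then show ?case using V_br[OF Suc y(1)] unfolding uS by (simp only:)
  qed (simp add: u0 x)
  have uC: "u j \<in> C (Suc j)" for j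
  proof (induction j)
    case (Suc j)
    then show ?case using lcs_br[of "u j" "Suc j" y] by (simp add: uS)
  qed simp
  have u1: "u 1 - scale (\<alpha> x * \<beta> y) (W 1 + Z) \<in> C 3"
  proof -
    have "scale (\<alpha> x) (scale (\<alpha> y + \<beta> y) (W 1) + scale (\<beta> y) Z) = scale (\<alpha> x * \<beta> y) (W 1 + Z)"
      by (simp only: y(2) add_0_left scale_right_distrib[symmetric] scale_scale)
    moreover have "u 1 = br x y" by (simp add: uS u0)
    ultimately show ?thesis using prod_gen[of x y] by (simp only:)
  qed
  \<comment> \<open>From the second product on, the \<open>Z\<close> part of \<open>u 1\<close> has
    disappeared by \<open>Z_br\<close>; each further product shifts \<open>W j\<close> and
    multiplies by \<open>\<beta> y\<close>.\<close>
  have u2: "u j - scale (\<alpha> x * \<beta> y ^ j) (W j) \<in> C (j + 2)" if "2 \<le> j" for j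
    using that
  proof (induction j rule: dec_induct)
    case base
    let ?c = "\<alpha> x * \<beta> y"
    have u12: "br (u 1) y = u 2" by (simp add: uS[symmetric] numeral_2_eq_2)
    have expand: "br (p - scale c (w + z)) y + scale c ((br w y - scale d w') + br z y) = br p y - scale (c * d) w'"
      for p c w z d w'
      by (simp add: br_diff_left br_scale_left br_add_left scale_right_distrib scale_right_diff_distrib)
    have 1: "br (u 1 - scale ?c (W 1 + Z)) y \<in> C 4"
      using lcs_br[OF u1, of y] by simp
    have 2: "br (W 1) y - scale (\<beta> y) (W 2) \<in> C 4"
      using prod_W[of 1 y] y(2) by (simp add: numeral_2_eq_2)
    have 3: "(br (W 1) y - scale (\<beta> y) (W 2)) + br Z y \<in> C 4"
      by (rule subspace_add[OF subspace_lcs 2 Z_br])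
    have "br (u 1 - scale ?c (W 1 + Z)) y + scale ?c ((br (W 1) y - scale (\<beta> y) (W 2)) + br Z y) \<in> C 4"
      by (rule subspace_add[OF subspace_lcs 1 subspace_scale[OF subspace_lcs 3]])
    also have "br (u 1 - scale ?c (W 1 + Z)) y + scale ?c ((br (W 1) y - scale (\<beta> y) (W 2)) + br Z y)
        = u 2 - scale (\<alpha> x * \<beta> y ^ 2) (W 2)"
      unfolding expand power2_eq_square u12 by (simp add: mult.assoc)
    finally show ?case by simp
  next
    case (step j)
    let ?c = "\<alpha> x * \<beta> y ^ j"
    have 1: "br (u j - scale ?c (W j)) y \<in> C (j + 3)"
      using lcs_br[OF step.IH, of y] by (simp add: eval_nat_numeral)
    have 2: "br (W j) y - scale (\<beta> y) (W (Suc j)) \<in> C (j + 3)"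
      using prod_W[of j y] y(2) step.hyps by simp
    have "br (u j - scale ?c (W j)) y + scale ?c (br (W j) y - scale (\<beta> y) (W (Suc j))) \<in> C (j + 3)"
      by (rule subspace_add[OF subspace_lcs 1 subspace_scale[OF subspace_lcs 2]])
    also have "br (u j - scale ?c (W j)) y + scale ?c (br (W j) y - scale (\<beta> y) (W (Suc j)))
        = u (Suc j) - scale (\<alpha> x * \<beta> y ^ Suc j) (W (Suc j))"
      by (simp add: br_diff_left br_scale_left scale_right_diff_distrib uS mult.assoc mult.commute[of "\<beta> y"])
    finally show ?case by (simp add: eval_nat_numeral)
  qed
  have x2: "x \<notin> C 2" and y2: "y \<notin> C 2" using lcs_crd_2 x y by auto
  have u1C: "u 1 \<notin> C 3" using prod_notin[of x y] x y by (simp add: uS u0)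
  have unz: "u j \<noteq> 0" if j: "j \<le> n - 3" for j
  proof -
    consider "j = 0" | "j = 1" | "2 \<le> j" by linarith
    then show ?thesis
    proof cases
      case 3
      have jn: "j < n - 2" using j n6 by linarith
      show ?thesis
      proof
        assume "u j = 0"
        \<comment> \<open>If \<open>u j\<close> were zero, \<open>u2\<close> would put a nonzero
          multiple of \<open>W j\<close> into \<open>C (j + 2)\<close>.\<close>
        then have "crd (W j) (0 - scale (\<alpha> x * \<beta> y ^ j) (W j)) = 0"
          using lcs_crd_W[OF _ jn, of "0 - scale (\<alpha> x * \<beta> y ^ j) (W j)"] u2[OF 3] 3 by simp
        then show False using x y jn by (simp only: crd_diff crd_scale crd_gens(9) crd_zero) simp
      qed
    qed (use u0 x u1C in auto)
  qed
  have s: "br x x \<in> V (2 * a)" "br x x \<notin> C 3" "br x x \<in> C 2"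
    using V_br[OF x(1) x(1)] prod_notin[of x x] x lcs_br[of x 1 x] by (simp_all add: numeral_2_eq_2)
  then have snz: "br x x \<noteq> 0" by auto
  have uC2: "u j \<in> C 2" if "1 \<le> j" for j using uC[of j] lcs_antimono[of 2 "Suc j"] that by auto
  have uC3: "u j \<in> C 3" if "2 \<le> j" for j using uC[of j] lcs_antimono[of 3 "Suc j"] that by auto
  have ab: "a \<noteq> b" using x y by (auto simp: x_def y_def)
  show False
  proof (rule degree_arith[OF n6, of b k a])
    \<comment> \<open>\<open>C 2\<close> contains \<open>u 1\<close> but not \<open>x\<close>, so
      their degrees differ.\<close>
    have "a \<noteq> a + int 1 * b"
      by (rule degree_distinct[OF x(1) x2 uV uC2 unz]) (use n6 in auto)
    then show "b \<noteq> 0" by simp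
    show "k \<le> a + int i * b \<and> a + int i * b \<le> k + int n" if "i \<le> n - 3" for i
      using V_degree[OF uV unz[OF that]] t_eq by simp
    show "k \<le> b" "b \<le> k + int n" using b(1) t_eq by auto
    show "k \<le> 2 * a" "2 * a \<le> k + int n" using V_degree[OF s(1) snz] t_eq by auto
    show "a + int i * b \<noteq> b" if "i \<le> n - 3" for i
    proof (cases i)
      case (Suc j)
      then show ?thesis
        using degree_distinct[OF y(1) y2 uV uC2 unz[OF that]] by auto
    qed (use ab in simp)
    \<comment> \<open>\<open>br x x\<close> lies in \<open>C 2\<close> but not in
      \<open>C 3\<close>: the former separates it from \<open>u 0\<close>, the latter from
      \<open>u i\<close> with i at least 2. For i = 1 equality would mean a = b.\<close>
    show "a + int i * b \<noteq> 2 * a" if "i \<le> n - 3" for i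
    proof -
      consider "i = 0" | "i = 1" | "2 \<le> i" by linarith
      then show ?thesis
      proof cases
        case 1
        then show ?thesis using degree_distinct[OF x(1) x2 s(1,3) snz] by simp
      next
        case 2
        then show ?thesis using ab by simp
      next
        case 3
        then show ?thesis using degree_distinct[OF s(1,2) uV uC3 unz[OF that]] by auto
      qed
    qed
    show "2 * a \<noteq> b" using degree_distinct[OF y(1) y2 s(1,3) snz] by auto
  qed
qed

end

section \<open>The bound on the length\<close>

theorem theorem2p5:
  fixes scale :: "complex \<Rightarrow> 'a::ab_group_add \<Rightarrow> 'a"
    and br :: "'a \<Rightarrow> 'a \<Rightarrow> 'a"
    and n :: nat
  assumes n: "n \<ge> 6"
    and leib: "leibniz_algebra scale br"
    and dim: "vector_space.dim scale (UNIV :: 'a set) = n + 1"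
    and filiform: "three_filiform scale br"
    and non_lie: "\<not> is_lie br"
    and gr: "calg_iso (gr_alg scale br) (calg_sum (KF5 n) null_alg1)"
  shows "alg_length scale br \<le> n"
proof -
  interpret leibniz_algebra scale br by (rule leib)
  have nilp: "nilpotent_alg scale br" using filiform by (simp add: three_filiform_def)
  obtain \<phi> where "gr_model scale br n \<phi>"
  proof -
    obtain \<phi> where "bij_betw \<phi> (cal_carrier G) (cal_carrier (calg_sum (KF5 n) null_alg1))"
      "\<forall>x\<in>cal_carrier G. \<forall>y\<in>cal_carrier G.
        \<phi> (cal_add G x y) = cal_add (calg_sum (KF5 n) null_alg1) (\<phi> x) (\<phi> y) \<and>
        \<phi> (cal_mult G x y) = cal_mult (calg_sum (KF5 n) null_alg1) (\<phi> x) (\<phi> y)"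
      "\<forall>c. \<forall>x\<in>cal_carrier G. \<phi> (cal_scale G c x) = cal_scale (calg_sum (KF5 n) null_alg1) c (\<phi> x)"
      using gr unfolding calg_iso_def by blast
    then have "gr_model scale br n \<phi>" using n nilp by unfold_locales auto
    then show ?thesis by (rule that)
  qed
  then obtain W Q R where "kf5_frame scale br n W Q R" using gr_model.ex_frame by blast
  then interpret kf5_basis scale br n W Q R
    by (rule kf5_basis.intro) (simp add: kf5_basis_axioms_def dim)
  have le: "t + 1 \<le> n" if "connected_gradation scale br V k t" for V k t
  proof -
    interpret graded_leibniz scale br V k t by unfold_locales (rule that)
    have "t + 1 \<noteq> n + 1"
    proof
      assume "t + 1 = n + 1"
      then interpret kf5_fine scale br n W Q R V k t by unfold_locales (simp add: dim)
      show False by (rule no_fine_gradation)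
    qed
    then show ?thesis using length_le_dim dim by simp
  qed
  let ?S = "{t + 1 | V k t. connected_gradation scale br V k t}"
  \<comment> \<open>The length is a \<open>Max\<close>, so the set of lengths has to be shown finite
    and nonempty before the bound transfers.\<close>
  have sub: "?S \<subseteq> {..n}" using le by auto
  then have fin: "finite ?S" by (rule finite_subset) simp
  have "?S \<noteq> {}"
  proof -
    \<comment> \<open>The trivial gradation, with the whole algebra in degree 0, shows that a
      connected gradation exists.\<close>
    have "connected_gradation scale br (\<lambda>i. if i = 0 then UNIV else {0}) 0 0"
    proof -
      have "(UNIV :: 'a set) \<noteq> {0}"
      proof
        assume "(UNIV :: 'a set) = {0}"
        then have "dim (UNIV :: 'a set) = 0" using dim_eq_card[of "{}" UNIV] by (simp add: independent_empty)
        then show False using dim by simp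
      qed
      moreover have "\<exists>!f. (\<forall>i::int. f i \<in> (if i = 0 then UNIV else {0})) \<and> x = f 0" for x :: 'a
      proof (rule ex1I)
        show "(\<forall>i::int. (if i = 0 then x else 0) \<in> (if i = 0 then UNIV else {0})) \<and>
          x = (if (0::int) = 0 then x else 0)" by simp
        fix f :: "int \<Rightarrow> 'a"
        assume f: "(\<forall>i. f i \<in> (if i = 0 then UNIV else {0})) \<and> x = f 0"
        show "f = (\<lambda>i. if i = 0 then x else 0)"
        proof
          fix i show "f i = (if i = 0 then x else 0)"
            using f[THEN conjunct1, THEN spec, of i] f[THEN conjunct2] by (cases "i = 0") simp_all
        qed
      qed
      ultimately show ?thesis by (simp add: connected_gradation_def)
    qed
    then show ?thesis by blast
  qed
  then have "Max ?S \<in> ?S" by (rule Max_in[OF fin])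
  then have "Max ?S \<in> {..n}" by (rule subsetD[OF sub])
  then show ?thesis unfolding alg_length_def by simp
qed

end
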